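(* Let $n\ge 1$ and let $\mathcal{F}$ be a family of subsets of $[n]=\{1,\dots,n\}$ with $|\mathcal{F}| = s \ge \binom{n}{\lfloor n/2\rfloor}$. Let $r\ge 0$ be the unique number with $r\in\frac12\mathbb{Z}$ and $\frac n2+r\in\mathbb{Z}$ such that \[ \sum_{i=\frac n2-r+1}^{\frac n2+r-1}\binom{n}{i} < s \le \sum_{i=\frac n2-r}^{\frac n2+r}\binom{n}{i}. \] Then $\mathcal{F}$ minimizes the number of $2$-chains among all families of $s$ subsets of $[n]$ if and only if all of the following hold: (1) every $F\in\mathcal{F}$ satisfies $\frac n2-r\le |F|\le \frac n2+r$; (2) every $A\subseteq[n]$ with $\frac n2-r+1\le |A|\le \frac n2+r-1$ belongs to $\mathcal{F}$; (3) if $s\le \sum_{i=\frac n2-r}^{\frac n2+r-1}\binom{n}{i}$, then $\{F\in\mathcal{F}: |F|=\frac n2\pm r\}$ is an antichain; (4) if $s\ge \sum_{i=\frac n2-r}^{\frac n2+r-1}\binom{n}{i}$, then $\{F\subseteq[n]: F\notin\mathcal{F},\ |F|=\frac n2\pm r\}$ is an antichain.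
   Context: A $2$-chain in a family $\mathcal{F}$ is a pair of sets $F_1,F_2\in\mathcal{F}$ with $F_1\subsetneq F_2$; the number of $2$-chains of $\mathcal{F}$ is the number of such pairs. An antichain is a family containing no $2$-chain. Sums with lower limit exceeding upper limit are $0$. *)

theory Defs
  imports Complex_Main
begin

definition two_chains :: "'a set set \<Rightarrow> ('a set \<times> 'a set) set" where
  "two_chains F = {(A, B). A \<in> F \<and> B \<in> F \<and> A \<subset> B}"

definition antichain :: "'a set set \<Rightarrow> bool" where
  "antichain F \<longleftrightarrow> two_chains F = {}"

definition minimizes_two_chains :: "nat \<Rightarrow> nat set set \<Rightarrow> bool" where
  "minimizes_two_chains n F \<longleftrightarrow> F \<subseteq> Pow {1..n} \<and>
     (\<forall>G. G \<subseteq> Pow {1..n} \<and> card G = card F \<longrightarrow> card (two_chains F) \<le> card (two_chains G))"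

text \<open>
  The bounds are real because they will have the form \<open>n/2 \<plusminus> r\<close> with \<open>r\<close> a half-integer; they
  are always integers where this is used. Negative indices are left out, as their binomial
  coefficients vanish. If \<open>a > b\<close> the sum is empty.
\<close>

definition binom_sum :: "nat \<Rightarrow> real \<Rightarrow> real \<Rightarrow> nat" where
  "binom_sum n a b = (\<Sum>i | a \<le> real i \<and> real i \<le> b. n choose i)"

definition is_radius :: "nat \<Rightarrow> nat \<Rightarrow> real \<Rightarrow> bool" where
  "is_radius n s r \<longleftrightarrow> 0 \<le> r \<and> 2 * r \<in> \<int> \<and> real n / 2 + r \<in> \<int> \<and>
     binom_sum n (real n / 2 - r + 1) (real n / 2 + r - 1) < s \<and>
     s \<le> binom_sum n (real n / 2 - r) (real n / 2 + r)"

lemma finite_binom_sum_index: "finite {i. a \<le> real i \<and> real i \<le> b}"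
proof (rule finite_subset)
  show "{i. a \<le> real i \<and> real i \<le> b} \<subseteq> {..nat \<lceil>b\<rceil>}"
    by (auto, linarith)
qed simp

lemma binom_sum_mono:
  assumes "a' \<le> a" "b \<le> b'"
  shows "binom_sum n a b \<le> binom_sum n a' b'"
  unfolding binom_sum_def
  by (rule sum_mono2) (use assms finite_binom_sum_index in auto)

lemma binom_sum_empty: "b < a \<Longrightarrow> binom_sum n a b = 0"
  unfolding binom_sum_def by (rule sum.neutral) auto

lemma ex1_radius:
  assumes "1 \<le> n" "n choose (n div 2) \<le> s" "s \<le> 2 ^ n"
  shows "\<exists>!r. is_radius n s r"
proof -
  have s: "0 < s"
    using assms(2) zero_less_binomial[of "n div 2" n] by linarith
  define U where "U m = binom_sum n (real n - m) m" for m :: real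
  have U_mono: "U a \<le> U b" if "a \<le> b" for a b
    unfolding U_def by (rule binom_sum_mono) (use that in auto)
  have U_zero: "U m = 0" if "m < real n / 2" for m
    unfolding U_def by (rule binom_sum_empty) (use that in linarith)
  have "{i. 0 \<le> real i \<and> real i \<le> real n} = {..n}"
    by auto
  then have U_n: "U (real n) = 2 ^ n"
    using choose_row_sum[of n] by (simp add: U_def binom_sum_def)
  have radius: "is_radius n s r \<longleftrightarrow> 0 \<le> r \<and> 2 * r \<in> \<int> \<and> real n / 2 + r \<in> \<int> \<and>
      U (real n / 2 + r - 1) < s \<and> s \<le> U (real n / 2 + r)" for r
  proof -
    have "real n - (real n / 2 + r - 1) = real n / 2 - r + 1"
         "real n - (real n / 2 + r) = real n / 2 - r"
      by (simp_all add: field_simps)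
    then show ?thesis unfolding is_radius_def U_def by (simp only:)
  qed
  define m where "m = (LEAST m::nat. s \<le> U (real m))"
  have m: "s \<le> U (real m)"
    unfolding m_def by (rule LeastI[of _ n]) (use assms(3) U_n in simp)
  have m_ge: "real n / 2 \<le> real m"
  proof (rule ccontr)
    assume "\<not> real n / 2 \<le> real m"
    then show False using U_zero[of "real m"] m s by simp
  qed
  then have "0 < m" using assms(1) by (cases m) auto
  then have m_less: "U (real m - 1) < s"
    using not_less_Least[of "m - 1" "\<lambda>m. s \<le> U (real m)"]
    by (simp add: m_def[symmetric] of_nat_diff not_le)
  have "is_radius n s (real m - real n / 2)"
    unfolding radius using m m_less m_ge by (simp add: algebra_simps)
  moreover have "r \<le> r'" if rr: "is_radius n s r" "is_radius n s r'" for r r'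
  proof (rule ccontr)
    assume less: "\<not> r \<le> r'"
    obtain k k' :: int where k:
      "real n / 2 + r = of_int k" "real n / 2 + r' = of_int k'"
      using rr unfolding radius by (meson Ints_cases)
    then have "real_of_int k' < real_of_int k" using less by linarith
    then have "k' \<le> k - 1" by simp
    then have "real_of_int k' \<le> real_of_int k - 1" by linarith
    then have "real n / 2 + r' \<le> real n / 2 + r - 1" using k by simp
    then show False
      using U_mono[of "real n / 2 + r'" "real n / 2 + r - 1"] rr by (auto simp: radius)
  qed
  ultimately show ?thesis by (meson order_antisym)
qed

end

theory Submission
  imports Defs "HOL-Combinatorics.Multiset_Permutations"
begin

text \<open>
  A uniformly random maximal chain of \<open>Pow {1..n}\<close> meets \<open>F\<close> in a random set \<open>X\<close> of levels. Weighting
  a pair \<open>i < j\<close> of levels by \<open>(n choose j) * (j choose i)\<close>, the number of 2-chains between the two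
  full layers, the expected weight of the pairs in \<open>X\<close> is exactly the number of 2-chains of \<open>F\<close>, and
  with weights \<open>n choose i\<close> the expected weight of \<open>X\<close> is \<open>card F\<close>. So for every multiplier \<open>d\<close>,
  minimising the number of 2-chains minus \<open>d * card F\<close> reduces to families that are unions of full
  layers, and a family is optimal iff every maximal chain meets it in an optimal set of levels.

  For unions of layers, exchanging the layer farthest from the middle for the nearest missing one
  shows that an optimal set of levels is a centred interval, possibly without one of its ends. Taking
  for \<open>d\<close> the number of members comparable to a set of size \<open>n/2 + r\<close> when the layers strictly
  inside, respectively also the layer \<open>n/2 - r\<close>, are full makes exactly the level sets of conditions
  (1)-(3), respectively (1), (2), (4), optimal.
\<close>

subsection \<open>Weighted sets of levels\<close>

definition level_weight :: "nat \<Rightarrow> nat set \<Rightarrow> nat" where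
  "level_weight n X = (\<Sum>i\<in>X. n choose i)"

definition level_chains :: "nat \<Rightarrow> nat set \<Rightarrow> nat" where
  "level_chains n X = (\<Sum>(i, j) | i \<in> X \<and> j \<in> X \<and> i < j. (n choose j) * (j choose i))"

text \<open>The number of sets in the layers \<open>X\<close> comparable to a fixed set of size \<open>c\<close> with \<open>c \<notin> X\<close>.\<close>

definition level_degree :: "nat \<Rightarrow> nat set \<Rightarrow> nat \<Rightarrow> nat" where
  "level_degree n X c =
     (\<Sum>i | i \<in> X \<and> i < c. c choose i) + (\<Sum>j | j \<in> X \<and> c < j. (n - c) choose (j - c))"

definition lagrangian :: "nat \<Rightarrow> nat \<Rightarrow> nat set \<Rightarrow> int" where
  "lagrangian n d X = int (level_chains n X) - int d * int (level_weight n X)"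

text \<open>The degree of a set of size \<open>b\<close> towards the \<open>q\<close> layers just
  below it, written with \<open>b choose j\<close> for \<open>b choose (b - j)\<close>. By
  complementation it is also the degree of a set of size \<open>n - b\<close> towards the
  \<open>q\<close> layers just above it, so one function measures both ends of a centred
  interval.\<close>

definition binom_partial :: "nat \<Rightarrow> nat \<Rightarrow> nat" where
  "binom_partial b q = (\<Sum>j = 1..q. b choose j)"

text \<open>Pascal's rule makes the last step strict. At \<open>j = 0\<close> both binomials are 1,
  an exception that the side condition \<open>2 \<le> d \<or> n \<le> 1\<close> handles
  later.\<close>

lemma binomial_less_top:
  assumes "m < b" "1 \<le> j" "j \<le> b"
  shows "m choose j < b choose j"
proof -
  obtain k where k: "j = Suc k" using assms(2) by (cases j) auto
  obtain b' where b: "b = Suc b'" using assms(1) by (cases b) auto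
  have "m choose j \<le> b' choose j"
    using assms(1) b by (intro binomial_right_mono) auto
  also have "\<dots> < b choose j" using assms k b by simp
  finally show ?thesis .
qed

lemma binom_partial_mono:
  assumes "b \<le> b'" "q \<le> q'"
  shows "binom_partial b q \<le> binom_partial b' q'"
proof -
  have "binom_partial b q \<le> (\<Sum>j = 1..q. b' choose j)"
    unfolding binom_partial_def by (intro sum_mono binomial_right_mono assms)
  also have "\<dots> \<le> binom_partial b' q'"
    unfolding binom_partial_def by (intro sum_mono2) (use assms in auto)
  finally show ?thesis .
qed

text \<open>The additional summand \<open>b' choose q'\<close> is positive because
  \<open>q' \<le> b'\<close>. This strictness is what pins down the reach of a minimiser.\<close>

lemma binom_partial_less:
  assumes "b \<le> b'" "q < q'" "q' \<le> b'"
  shows "binom_partial b q < binom_partial b' q'"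
proof -
  obtain p where p: "q' = Suc p" using assms(2) by (cases q') auto
  have "binom_partial b q \<le> binom_partial b' p"
    using assms p by (intro binom_partial_mono) auto
  also have "\<dots> < binom_partial b' q'"
    using assms p by (simp add: binom_partial_def)
  finally show ?thesis .
qed

text \<open>For \<open>c\<close> in the lower half, reflecting \<open>b\<close> to
  \<open>n - b\<close> turns the claim into strict growth towards the middle.\<close>

lemma binomial_less_inner:
  assumes "n - b < c" "c < b" "b \<le> n"
  shows "n choose b < n choose c"
proof (cases "2 * c \<le> n")
  case True
  then have "n choose (n - b) < n choose c"
    using assms by (intro binomial_strict_mono) auto
  then show ?thesis using assms by (simp add: binomial_symmetric[of b n])
next
  case False
  then show ?thesis using assms by (intro binomial_strict_antimono) auto
qed

text \<open>Each new pair has \<open>c\<close> as one entry. For \<open>j\<close> above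
  \<open>c\<close>, \<open>choose_mult\<close> counts the pairs from the smaller set instead of the
  larger one, so that \<open>n choose c\<close> factors out.\<close>

lemma level_chains_insert:
  assumes "X \<subseteq> {..n}" "c \<notin> X" "c \<le> n"
  shows "level_chains n (insert c X) = level_chains n X + (n choose c) * level_degree n X c"
proof -
  have fin: "finite X" using assms(1) finite_subset by blast
  let ?g = "\<lambda>(i, j). (n choose j) * (j choose i)"
  let ?P = "{(i, j). i \<in> X \<and> j \<in> X \<and> i < j}"
  let ?D = "(\<lambda>i. (i, c)) ` {i. i \<in> X \<and> i < c}"
  let ?U = "(\<lambda>j. (c, j)) ` {j. j \<in> X \<and> c < j}"
  have split: "{(i, j). i \<in> insert c X \<and> j \<in> insert c X \<and> i < j} = ?P \<union> ?D \<union> ?U"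
    by auto
  have finP: "finite ?P" by (rule finite_subset[of _ "X \<times> X"]) (use fin in auto)
  have "level_chains n (insert c X) = sum ?g (?P \<union> ?D \<union> ?U)"
    unfolding level_chains_def split[symmetric] ..
  also have "\<dots> = sum ?g (?P \<union> ?D) + sum ?g ?U"
    by (intro sum.union_disjoint) (use fin finP assms(2) in auto)
  also have "sum ?g (?P \<union> ?D) = sum ?g ?P + sum ?g ?D"
    by (intro sum.union_disjoint) (use fin finP assms(2) in auto)
  also have "sum ?g ?P = level_chains n X" unfolding level_chains_def ..
  also have "sum ?g ?D = (n choose c) * (\<Sum>i | i \<in> X \<and> i < c. c choose i)"
    by (subst sum.reindex) (auto simp: inj_on_def sum_distrib_left)
  also have "sum ?g ?U = (\<Sum>j | j \<in> X \<and> c < j. (n choose j) * (j choose c))"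
    by (subst sum.reindex) (auto simp: inj_on_def)
  also have "\<dots> = (n choose c) * (\<Sum>j | j \<in> X \<and> c < j. (n - c) choose (j - c))"
    unfolding sum_distrib_left
    by (intro sum.cong refl choose_mult) (use assms(1) in auto)
  finally show ?thesis by (simp add: level_degree_def algebra_simps)
qed

text \<open>As \<open>n choose c\<close> is positive, adding level \<open>c\<close> lowers the
  Lagrangian exactly when its degree is below \<open>d\<close>. The exchange and minimality tests
  below use this sign.\<close>

lemma lagrangian_insert:
  assumes "X \<subseteq> {..n}" "c \<notin> X" "c \<le> n"
  shows "lagrangian n d (insert c X) =
    lagrangian n d X + int (n choose c) * (int (level_degree n X c) - int d)"
proof -
  have "finite X" using assms(1) finite_subset by blast
  then have "level_weight n (insert c X) = (n choose c) + level_weight n X"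
    using assms(2) by (simp add: level_weight_def)
  then show ?thesis
    by (simp add: lagrangian_def level_chains_insert[OF assms] algebra_simps)
qed

text \<open>Complementation reverses inclusion, so the layers \<open>i < j\<close> go to
  \<open>n - j < n - i\<close> with the same number of 2-chains between them.\<close>

lemma level_chains_reflect:
  assumes "X \<subseteq> {..n}"
  shows "level_chains n ((\<lambda>i. n - i) ` X) = level_chains n X"
  unfolding level_chains_def
proof (rule sum.reindex_bij_witness[of _ "\<lambda>(i, j). (n - j, n - i)" "\<lambda>(i, j). (n - j, n - i)"])
  fix p assume p: "p \<in> {(i, j). i \<in> (\<lambda>i. n - i) ` X \<and> j \<in> (\<lambda>i. n - i) ` X \<and> i < j}"
  then obtain i j where ij: "p = (n - i, n - j)" "i \<in> X" "j \<in> X" "n - i < n - j" by auto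
  then have *: "i \<le> n" "j < i" using assms by auto
  then show "(case (case p of (i, j) \<Rightarrow> (n - j, n - i)) of (i, j) \<Rightarrow> (n choose j) * (j choose i)) =
         (case p of (i, j) \<Rightarrow> (n choose j) * (j choose i))"
    using ij choose_mult[of j i n] binomial_symmetric[of "i - j" "n - j"]
    by (simp add: binomial_symmetric[of j n])
next
  fix p assume p: "p \<in> {(i, j). i \<in> X \<and> j \<in> X \<and> i < j}"
  then show "(case p of (i, j) \<Rightarrow> (n - j, n - i)) \<in>
      {(i, j). i \<in> (\<lambda>i. n - i) ` X \<and> j \<in> (\<lambda>i. n - i) ` X \<and> i < j}"
    using assms by (auto simp: subset_iff)
qed (use assms in \<open>auto simp: subset_iff\<close>)

lemma lagrangian_reflect:
  assumes "X \<subseteq> {..n}"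
  shows "lagrangian n d ((\<lambda>i. n - i) ` X) = lagrangian n d X"
proof -
  have "inj_on (\<lambda>i. n - i) X" by (rule inj_onI) (use assms in \<open>auto simp: subset_iff\<close>, metis diff_diff_cancel)
  then have "level_weight n ((\<lambda>i. n - i) ` X) = (\<Sum>i\<in>X. n choose (n - i))"
    by (simp add: level_weight_def sum.reindex)
  also have "\<dots> = level_weight n X"
    unfolding level_weight_def by (rule sum.cong[OF refl], rule binomial_symmetric[symmetric]) (use assms in auto)
  finally show ?thesis by (simp add: lagrangian_def level_chains_reflect[OF assms])
qed

subsection \<open>Optimal sets of levels\<close>

text \<open>If a level nearer to the middle than the farthest level \<open>b\<close> is missing, let \<open>c\<close> be the highest
  such level. Swapping \<open>b\<close> for \<open>c\<close> does not increase the degree and makes the layer larger, so the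
  Lagrangian drops, unless \<open>c = n - b\<close>.\<close>

lemma optimal_upper_form:
  assumes X: "X \<subseteq> {..n}" and b: "b \<in> X" and ends: "\<And>a. a \<in> X \<Longrightarrow> n - b \<le> a \<and> a \<le> b"
    and d: "0 < d" "2 \<le> d \<or> n \<le> 1"
    and opt: "\<And>Y. Y \<subseteq> {..n} \<Longrightarrow> lagrangian n d X \<le> lagrangian n d Y"
  shows "X = {n - b..b} \<or> X = {n - b<..b}"
proof (rule ccontr)
  assume neg: "\<not> ?thesis"
  have bn: "b \<le> n" and fin: "finite X" using X b finite_subset by auto
  define G where "G = {n - b..b} - X"
  have "X \<subseteq> {n - b..b}" using ends by auto
  then have G: "finite G" "G \<noteq> {}" using neg by (auto simp: G_def)
  define c where "c = Max G"
  have "c \<in> G" using Max_in[OF G] by (simp add: c_def)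
  then have c: "c \<notin> X" "n - b \<le> c" "c < b" using b by (auto simp: G_def order_le_less)
  have above: "a \<in> X" if "c < a" "a \<le> b" for a
  proof (rule ccontr)
    assume "a \<notin> X"
    then have "a \<in> G" using that c by (auto simp: G_def)
    then show False using Max_ge[OF G(1)] that c_def by fastforce
  qed
  have c_gt: "n - b < c"
  proof (rule ccontr)
    assume "\<not> n - b < c"
    then have "c = n - b" using c by simp
    have "n - b < a" if "a \<in> X" for a
      using ends[OF that] that c(1) \<open>c = n - b\<close> by (cases "a = n - b") auto
    moreover have "a \<in> X" if "a \<in> {n - b<..b}" for a
      using that \<open>c = n - b\<close> by (intro above) auto
    ultimately have "X = {n - b<..b}" using ends by (meson greaterThanAtMost_iff subsetI subset_antisym)
    then show False using neg by simp
  qed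
  define Y where "Y = X - {b}"
  have Y: "Y \<subseteq> {..n}" "b \<notin> Y" "c \<notin> Y" and XY: "X = insert b Y"
    using X b c by (auto simp: Y_def)
  have below: "a < b" if "a \<in> Y" for a
    using ends[of a] that by (auto simp: Y_def order_le_less)
  define L where "L = {a \<in> Y. a < c}"
  have Y_eq: "Y = L \<union> {c<..<b}"
    using below above c(1) Y(3) by (auto simp: L_def Y_def not_less order_le_less)
  have finL: "finite L" using fin by (auto simp: L_def Y_def)
  have deg_b: "level_degree n Y b = (\<Sum>a\<in>L. b choose a) + (\<Sum>a\<in>{c<..<b}. b choose (a - c))"
  proof -
    have "{a \<in> Y. a < b} = L \<union> {c<..<b}" "{a \<in> Y. b < a} = {}"
      using below Y_eq by force+
    then have "level_degree n Y b = (\<Sum>a\<in>L \<union> {c<..<b}. b choose a)"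
      by (simp only: level_degree_def sum.empty add_0_right)
    also have "\<dots> = (\<Sum>a\<in>L. b choose a) + (\<Sum>a\<in>{c<..<b}. b choose a)"
      by (intro sum.union_disjoint finL) (auto simp: L_def)
    \<comment> \<open>Reversing the layers between \<open>c\<close> and \<open>b\<close> allows a
      termwise comparison with the supersets of a \<open>c\<close>-set:
      \<open>b choose (a - c)\<close> against \<open>(n - c) choose (a - c)\<close>, where
      \<open>n - c < b\<close>.\<close>
    also have "(\<Sum>a\<in>{c<..<b}. b choose a) = (\<Sum>a\<in>{c<..<b}. b choose (a - c))"
    proof (rule sum.reindex_bij_witness[of _ "\<lambda>a. b + c - a" "\<lambda>a. b + c - a"])
      fix a assume "a \<in> {c<..<b}"
      then show "b choose (b + c - a - c) = b choose a"
        using binomial_symmetric[of a b] by simp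
    qed auto
    finally show ?thesis .
  qed
  have deg_c: "level_degree n Y c = (\<Sum>a\<in>L. c choose a) + (\<Sum>a\<in>{c<..<b}. (n - c) choose (a - c))"
  proof -
    have "{c<..<b} \<subseteq> Y" using Y_eq by blast
    then have "{a \<in> Y. c < a} = {c<..<b}" using below by auto
    then show ?thesis by (simp add: level_degree_def L_def)
  qed
  have leL: "(\<Sum>a\<in>L. c choose a) \<le> (\<Sum>a\<in>L. b choose a)"
    using c by (intro sum_mono binomial_right_mono) auto
  have leM: "(\<Sum>a\<in>{c<..<b}. (n - c) choose (a - c)) \<le> (\<Sum>a\<in>{c<..<b}. b choose (a - c))"
    using c by (intro sum_mono binomial_right_mono) auto
  have le: "level_degree n Y c \<le> level_degree n Y b"
    unfolding deg_b deg_c using leL leM by (rule add_mono)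
  have pos: "0 < n choose b" using bn by simp
  have less: "n choose b < n choose c" using binomial_less_inner c_gt c bn by simp
  have "lagrangian n d X \<le> lagrangian n d Y" by (rule opt[OF Y(1)])
  then have "int (n choose b) * (int (level_degree n Y b) - int d) \<le> 0"
    unfolding XY lagrangian_insert[OF Y(1,2) bn] by simp
  then have deg_le: "level_degree n Y b \<le> d"
    using pos by (simp add: mult_le_0_iff)
  have "lagrangian n d X \<le> lagrangian n d (insert c Y)"
    by (rule opt) (use Y c bn in auto)
  then have swap: "int (n choose b) * (int (level_degree n Y b) - int d)
      \<le> int (n choose c) * (int (level_degree n Y c) - int d)"
    unfolding XY lagrangian_insert[OF Y(1,2) bn]
    using lagrangian_insert[OF Y(1,3)] c bn by simp
  \<comment> \<open>Both brackets in \<open>swap\<close> are at most 0. If the one for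
    \<open>c\<close> were negative, the larger layer \<open>c\<close> would make the exchange a
    strict gain.\<close>
  have "level_degree n Y c = d"
  proof (rule ccontr)
    assume "level_degree n Y c \<noteq> d"
    then have lt: "int (level_degree n Y c) - int d < 0" using le deg_le by linarith
    have "int (n choose c) * (int (level_degree n Y c) - int d)
        < int (n choose b) * (int (level_degree n Y c) - int d)"
      using less lt by (intro mult_strict_right_mono_neg) auto
    also have "\<dots> \<le> int (n choose b) * (int (level_degree n Y b) - int d)"
      using le by (intro mult_left_mono) auto
    finally show False using swap by linarith
  qed
  then have eq: "level_degree n Y c = d" "level_degree n Y b = d"
    using le deg_le by simp_all
  have eqL: "(\<Sum>a\<in>L. c choose a) = (\<Sum>a\<in>L. b choose a)"
   and eqM: "(\<Sum>a\<in>{c<..<b}. (n - c) choose (a - c)) = (\<Sum>a\<in>{c<..<b}. b choose (a - c))"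
    using eq leL leM unfolding deg_b deg_c by linarith+
  \<comment> \<open>The degrees agree, so all termwise comparisons are equalities. The terms above
    \<open>c\<close> are strict since \<open>n - c < b\<close>, those below since
    \<open>c < b\<close>, except at \<open>a = 0\<close>. Hence \<open>Y\<close> contains at most
    the level 0.\<close>
  have M: "{c<..<b} = {}"
  proof (rule ccontr)
    assume "{c<..<b} \<noteq> {}"
    then have "(\<Sum>a\<in>{c<..<b}. (n - c) choose (a - c)) < (\<Sum>a\<in>{c<..<b}. b choose (a - c))"
      using c_gt c by (intro sum_strict_mono binomial_less_top) auto
    then show False using eqM by simp
  qed
  have L0: "a = 0" if "a \<in> L" for a
  proof (rule ccontr)
    assume "a \<noteq> 0"
    then have "c choose a < b choose a"
      using that c by (intro binomial_less_top) (auto simp: L_def)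
    then have "(\<Sum>a\<in>L. c choose a) < (\<Sum>a\<in>L. b choose a)"
      using that c finL by (intro sum_strict_mono_ex1 ballI binomial_right_mono) auto
    then show False using eqL by simp
  qed
  then have L: "L \<subseteq> {0}" by auto
  \<comment> \<open>With only the empty set below, the common degree is 1, which
    \<open>2 \<le> d\<close> excludes; for \<open>n \<le> 1\<close> there is no room for
    \<open>n - b < c < b\<close>.\<close>
  have "L \<noteq> {}" using eq(2) d(1) unfolding deg_b M by auto
  then have L: "L = {0}" using L by blast
  then have "d = 1" using eq(2) unfolding deg_b M by simp
  then have "n \<le> 1" using d(2) by simp
  then show False using c_gt c bn by simp
qed

lemma optimal_form:
  assumes X: "X \<subseteq> {..n}" "X \<noteq> {}"
    and d: "0 < d" "2 \<le> d \<or> n \<le> 1"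
    and opt: "\<And>Y. Y \<subseteq> {..n} \<Longrightarrow> lagrangian n d X \<le> lagrangian n d Y"
  obtains b where "b \<le> n" "n - b \<le> b" "X = {n - b..b}"
    | b where "b \<le> n" "n - b < b" "X = {n - b<..b}"
    | b where "b \<le> n" "n - b < b" "X = {n - b..<b}"
proof -
  have fin: "finite X" using X(1) finite_subset by blast
  note form = that
  have up: thesis if "X = {n - b..b} \<or> X = {n - b<..b}" "b \<in> X" for b
  proof -
    have "b \<le> n" using that(2) X(1) by auto
    from that(1) show thesis
    proof
      assume *: "X = {n - b..b}"
      then have "n - b \<le> b" using that(2) by simp
      then show thesis using form(1) * \<open>b \<le> n\<close> by blast
    next
      assume *: "X = {n - b<..b}"
      then have "n - b < b" using that(2) by simp
      then show thesis using form(2) * \<open>b \<le> n\<close> by blast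
    qed
  qed
  show thesis
  proof (cases "n - Min X \<le> Max X")
    case True
    have "X = {n - Max X..Max X} \<or> X = {n - Max X<..Max X}"
    proof (rule optimal_upper_form[OF X(1) _ _ d opt])
      fix a assume "a \<in> X"
      then have "Min X \<le> a" "a \<le> Max X" using fin by auto
      then show "n - Max X \<le> a \<and> a \<le> Max X" using True by linarith
    qed (use fin X in auto)
    then show ?thesis using up Max_in[OF fin X(2)] by simp
  next
    case False
    \<comment> \<open>The level farthest from the middle is now \<open>Min X\<close>; reflection
      turns it into the top level \<open>b\<close>.\<close>
    define b where "b = n - Min X"
    define X' where "X' = (\<lambda>i. n - i) ` X"
    have sub: "X' \<subseteq> {..n}" by (auto simp: X'_def)
    have form': "X' = {n - b..b} \<or> X' = {n - b<..b}"
    proof (rule optimal_upper_form[OF sub _ _ d])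
      show "b \<in> X'" using fin X by (simp add: b_def X'_def)
    next
      fix a assume "a \<in> X'"
      then obtain x where "x \<in> X" "a = n - x" by (auto simp: X'_def)
      moreover have "Min X \<le> x" "x \<le> Max X" using fin \<open>x \<in> X\<close> by auto
      ultimately show "n - b \<le> a \<and> a \<le> b" using False by (auto simp: b_def)
    next
      fix Y assume "Y \<subseteq> {..n}"
      then show "lagrangian n d X' \<le> lagrangian n d Y"
        unfolding X'_def lagrangian_reflect[OF X(1)] by (rule opt)
    qed
    have "b \<le> n" "b \<in> X'" using fin X by (auto simp: b_def X'_def)
    have mem: "i \<in> X \<longleftrightarrow> i \<le> n \<and> n - i \<in> X'" for i
    proof
      assume "i \<in> X"
      then show "i \<le> n \<and> n - i \<in> X'" using X(1) by (auto simp: X'_def)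
    next
      assume *: "i \<le> n \<and> n - i \<in> X'"
      then obtain j where "j \<in> X" "n - i = n - j" by (auto simp: X'_def)
      then have "j = i" using * X(1) by (auto simp: eq_diff_iff)
      then show "i \<in> X" using \<open>j \<in> X\<close> by simp
    qed
    from form' show ?thesis
    proof
      assume *: "X' = {n - b..b}"
      have "i \<in> X \<longleftrightarrow> i \<in> {n - b..b}" for i
        unfolding mem * using \<open>b \<le> n\<close> by auto
      then have "X = {n - b..b}" by blast
      then show ?thesis using that(1)[of b] * \<open>b \<le> n\<close> \<open>b \<in> X'\<close> by auto
    next
      assume *: "X' = {n - b<..b}"
      have "i \<in> X \<longleftrightarrow> i \<in> {n - b..<b}" for i
        unfolding mem * using \<open>b \<le> n\<close> by auto
      then have "X = {n - b..<b}" by blast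
      then show ?thesis using that(3)[of b] * \<open>b \<le> n\<close> \<open>b \<in> X'\<close> by auto
    qed
  qed
qed

lemma lagrangian_minimizer_exists:
  obtains X where "X \<subseteq> {..n}" "\<And>Y. Y \<subseteq> {..n} \<Longrightarrow> lagrangian n d X \<le> lagrangian n d Y"
proof -
  have "\<exists>X\<in>Pow {..n}. \<forall>Y\<in>Pow {..n}. lagrangian n d X \<le> lagrangian n d Y"
    using arg_min_if_finite(1)[of "Pow {..n}" "lagrangian n d"]
      arg_min_least[of "Pow {..n}" _ "lagrangian n d"] by blast
  then show thesis using that by blast
qed

section \<open>Degrees at the ends of an interval of levels\<close>

lemma sum_choose_above:
  assumes "a \<le> b"
  shows "(\<Sum>i\<in>{a..<b}. b choose i) = binom_partial b (b - a)"
  unfolding binom_partial_def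
proof (rule sum.reindex_bij_witness[of _ "\<lambda>j. b - j" "\<lambda>i. b - i"])
  fix i assume "i \<in> {a..<b}"
  then show "b choose (b - i) = b choose i" using binomial_symmetric[of i b] by simp
qed (use assms in auto)

lemma level_degree_top:
  assumes "a \<le> b"
  shows "level_degree n {a..<b} b = binom_partial b (b - a)"
proof -
  have "{i \<in> {a..<b}. i < b} = {a..<b}" "{j \<in> {a..<b}. b < j} = {}" by auto
  then show ?thesis by (simp only: level_degree_def sum_choose_above[OF assms] sum.empty)
qed

text \<open>A set of size \<open>a\<close> has \<open>b\<close> elements outside it, so its
  supersets of size \<open>a + j\<close> correspond to the \<open>j\<close>-subsets of a
  \<open>b\<close>-set.\<close>

lemma level_degree_bottom:
  assumes "n - a = b" "a \<le> n"
  shows "level_degree n {a<..c} a = binom_partial b (c - a)"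
proof -
  have "{i \<in> {a<..c}. i < a} = {}" "{j \<in> {a<..c}. a < j} = {a<..c}" by auto
  then have "level_degree n {a<..c} a = (\<Sum>j\<in>{a<..c}. (n - a) choose (j - a))"
    by (simp only: level_degree_def sum.empty)
  also have "\<dots> = binom_partial b (c - a)"
    unfolding binom_partial_def assms(1)
    by (rule sum.reindex_bij_witness[of _ "\<lambda>j. j + a" "\<lambda>j. j - a"]) auto
  finally show ?thesis by simp
qed

text \<open>Deleting the layer \<open>c\<close> must not lower the Lagrangian;
  \<open>minimizer_degree_ge\<close> is the matching test for adding a layer.\<close>

lemma minimizer_degree_le:
  assumes "X \<subseteq> {..n}" "c \<notin> X" "c \<le> n"
    "\<And>Y. Y \<subseteq> {..n} \<Longrightarrow> lagrangian n d (insert c X) \<le> lagrangian n d Y"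
  shows "level_degree n X c \<le> d"
proof -
  have "int (n choose c) * (int (level_degree n X c) - int d) \<le> 0"
    using assms(4)[OF assms(1)] unfolding lagrangian_insert[OF assms(1-3)] by simp
  moreover have "0 < n choose c" using assms(3) by simp
  ultimately show ?thesis by (simp add: mult_le_0_iff)
qed

lemma minimizer_degree_ge:
  assumes "X \<subseteq> {..n}" "c \<notin> X" "c \<le> n"
    "\<And>Y. Y \<subseteq> {..n} \<Longrightarrow> lagrangian n d X \<le> lagrangian n d Y"
  shows "d \<le> level_degree n X c"
proof -
  have "0 \<le> int (n choose c) * (int (level_degree n X c) - int d)"
    using assms(4)[of "insert c X"] assms(1,3) unfolding lagrangian_insert[OF assms(1-3)] by simp
  moreover have "0 < n choose c" using assms(3) by simp
  ultimately show ?thesis by (simp add: zero_le_mult_iff)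
qed

text \<open>A minimiser is determined by how far it reaches: its extreme level has degree at most \<open>d\<close>
  and the next missing level has degree at least \<open>d\<close>, and both degrees grow with the reach.\<close>

lemma minimizer_degrees:
  assumes X: "X \<subseteq> {..n}"
    and d: "0 < d" "2 \<le> d \<or> n \<le> 1"
    and opt: "\<And>Y. Y \<subseteq> {..n} \<Longrightarrow> lagrangian n d X \<le> lagrangian n d Y"
  obtains b where "b \<le> n" "n - b \<le> b" "X = {n - b..b}" "binom_partial b (2 * b - n) \<le> d"
      "b < n \<Longrightarrow> d \<le> binom_partial (b + 1) (2 * b + 1 - n)"
    | b where "b \<le> n" "n - b < b" "X = {n - b<..b} \<or> X = {n - b..<b}"
      "binom_partial b (2 * b - n - 1) \<le> d" "d \<le> binom_partial b (2 * b - n)"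
proof -
  \<comment> \<open>Level 0 would have degree 0, below the positive multiplier, so adding it would
    be a gain.\<close>
  have "X \<noteq> {}"
  proof
    assume "X = {}"
    then have "d \<le> level_degree n {} 0" using minimizer_degree_ge[of "{}" n 0 d] opt by auto
    then show False using d(1) by (simp add: level_degree_def)
  qed
  from X this d opt show thesis
  proof (rule optimal_form)
    fix b assume b: "b \<le> n" "n - b \<le> b" "X = {n - b..b}"
    have "X = insert b {n - b..<b}" using b by auto
    then have "level_degree n {n - b..<b} b \<le> d"
      using opt b by (intro minimizer_degree_le) auto
    then have 1: "binom_partial b (2 * b - n) \<le> d"
      using b level_degree_top[of "n - b" b n] by (simp add: mult_2)
    \<comment> \<open>For \<open>b = n\<close> all layers are present and no missing one is left to
      test.\<close>
    have 2: "d \<le> binom_partial (b + 1) (2 * b + 1 - n)" if "b < n"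
    proof -
      have "X = {n - b..<b + 1}" using b by auto
      then have "d \<le> level_degree n {n - b..<b + 1} (b + 1)"
        using opt b that by (intro minimizer_degree_ge) auto
      then show ?thesis
        using b that level_degree_top[of "n - b" "b + 1" n] by (simp add: mult_2)
    qed
    show thesis using that(1)[OF b 1 2] .
  next
    fix b assume b: "b \<le> n" "n - b < b" "X = {n - b<..b}"
    have "X = insert b {n - b + 1..<b}" using b by auto
    then have "level_degree n {n - b + 1..<b} b \<le> d"
      using opt b by (intro minimizer_degree_le) auto
    then have 1: "binom_partial b (2 * b - n - 1) \<le> d"
      using b level_degree_top[of "n - b + 1" b n] by (simp add: mult_2)
    have "d \<le> level_degree n {n - b<..b} (n - b)"
      using opt b by (intro minimizer_degree_ge) auto
    then have 2: "d \<le> binom_partial b (2 * b - n)"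
      using b level_degree_bottom[of n "n - b" b b] by (simp add: mult_2)
    show thesis using that(2)[OF b(1,2) _ 1 2] b(3) by blast
  next
    fix b assume b: "b \<le> n" "n - b < b" "X = {n - b..<b}"
    have "X = insert (n - b) {n - b<..b - 1}" using b by auto
    then have "level_degree n {n - b<..b - 1} (n - b) \<le> d"
      using opt b by (intro minimizer_degree_le) auto
    moreover have "b - 1 - (n - b) = 2 * b - n - 1" using b by linarith
    ultimately have 1: "binom_partial b (2 * b - n - 1) \<le> d"
      using b level_degree_bottom[of n "n - b" b "b - 1"] by simp
    have "d \<le> level_degree n {n - b..<b} b"
      using opt b by (intro minimizer_degree_ge) auto
    then have 2: "d \<le> binom_partial b (2 * b - n)"
      using b level_degree_top[of "n - b" b n] by (simp add: mult_2)
    show thesis using that(2)[OF b(1,2) _ 1 2] b(3) by blast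
  qed
qed

section \<open>The two critical multipliers and their minimisers\<close>

definition inner_levels :: "nat \<Rightarrow> nat \<Rightarrow> nat set \<Rightarrow> bool" where
  "inner_levels lo hi X \<longleftrightarrow> X = {lo<..<hi} \<or> X = {lo<..hi} \<or> X = {lo..<hi}"

definition outer_levels :: "nat \<Rightarrow> nat \<Rightarrow> nat set \<Rightarrow> bool" where
  "outer_levels lo hi X \<longleftrightarrow> X = {lo..hi} \<or> X = {lo<..hi} \<or> X = {lo..<hi}"

text \<open>For \<open>lo + hi = n\<close> this is the degree of either end when just the layers
  strictly between are full: adding one end leaves the Lagrangian unchanged, adding the second one
  raises it.\<close>

definition inner_degree :: "nat \<Rightarrow> nat \<Rightarrow> nat" where
  "inner_degree lo hi = binom_partial hi (hi - lo - 1)"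

text \<open>For \<open>lo + hi = n\<close> this is the degree of either end when the other end and
  the layers between are full: removing one end from \<open>{lo..hi}\<close> leaves the Lagrangian
  unchanged.\<close>

definition outer_degree :: "nat \<Rightarrow> nat \<Rightarrow> nat" where
  "outer_degree lo hi = binom_partial hi (hi - lo)"

text \<open>Used with \<open>b = hi\<close> to see that both multipliers satisfy the side conditions
  \<open>0 < d\<close> and \<open>2 \<le> d \<or> n \<le> 1\<close> of
  \<open>minimizer_degrees\<close>.\<close>

lemma binom_partial_ge_top: "0 < q \<Longrightarrow> b \<le> binom_partial b q"
  using binom_partial_mono[of b b 1 q] by (simp add: binom_partial_def)

text \<open>A centred interval reaching \<open>hi\<close> has ends of degree above \<open>d\<close>,
  and one stopping short of \<open>hi - 1\<close> misses a layer of degree below \<open>d\<close>;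
  an interval lacking one end must reach exactly \<open>hi\<close>. With \<open>hi = lo + 1\<close>
  the multiplier would be 0, hence the gap of 2.\<close>

lemma minimizer_inner:
  assumes n: "lo + hi = n" "lo + 2 \<le> hi" and X: "X \<subseteq> {..n}"
    and opt: "\<And>Y. Y \<subseteq> {..n} \<Longrightarrow>
      lagrangian n (inner_degree lo hi) X \<le> lagrangian n (inner_degree lo hi) Y"
  shows "inner_levels lo hi X"
proof -
  define d where "d = inner_degree lo hi"
  have d: "hi \<le> d" "d = binom_partial hi (2 * hi - n - 1)"
    using n binom_partial_ge_top[of "hi - lo - 1" hi] by (auto simp: d_def inner_degree_def mult_2)
  have d': "0 < d" "2 \<le> d \<or> n \<le> 1" using d(1) n by linarith+
  from X d' opt[folded d_def] show ?thesis
  proof (rule minimizer_degrees)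
    fix b assume b: "b \<le> n" "n - b \<le> b" "X = {n - b..b}" "binom_partial b (2 * b - n) \<le> d"
      "b < n \<Longrightarrow> d \<le> binom_partial (b + 1) (2 * b + 1 - n)"
    have "b < hi"
    proof (rule ccontr)
      assume "\<not> b < hi"
      then have "d < binom_partial b (2 * b - n)"
        unfolding d(2) using n b by (intro binom_partial_less) auto
      then show False using b by simp
    qed
    moreover have "hi \<le> b + 1"
    proof (rule ccontr)
      assume "\<not> hi \<le> b + 1"
      then have "binom_partial (b + 1) (2 * b + 1 - n) < d"
        unfolding d(2) using n b by (intro binom_partial_less) auto
      then show False using b \<open>b < hi\<close> n by simp
    qed
    ultimately have "hi = b + 1" "n - b = Suc lo" using n by auto
    then have "X = {lo<..<hi}" using b by auto
    then show ?thesis by (simp add: inner_levels_def)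
  next
    fix b assume b: "b \<le> n" "n - b < b" "X = {n - b<..b} \<or> X = {n - b..<b}"
      "binom_partial b (2 * b - n - 1) \<le> d" "d \<le> binom_partial b (2 * b - n)"
    have "b \<le> hi"
    proof (rule ccontr)
      assume "\<not> b \<le> hi"
      then have "d < binom_partial b (2 * b - n - 1)"
        unfolding d(2) using n b by (intro binom_partial_less) auto
      then show False using b by simp
    qed
    moreover have "hi \<le> b"
    proof (rule ccontr)
      assume "\<not> hi \<le> b"
      then have "binom_partial b (2 * b - n) < d"
        unfolding d(2) using n b by (intro binom_partial_less) auto
      then show False using b by simp
    qed
    ultimately have "b = hi" by simp
    moreover have "n - hi = lo" using n by simp
    ultimately show ?thesis using b(3) by (auto simp: inner_levels_def)
  qed
qed

text \<open>Now a full centred interval must reach \<open>hi\<close> as well: one going further has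
  ends of degree above \<open>d\<close>, and a shorter one misses a layer of degree below
  \<open>d\<close>.\<close>

lemma minimizer_outer:
  assumes n: "lo + hi = n" "lo < hi" and X: "X \<subseteq> {..n}"
    and opt: "\<And>Y. Y \<subseteq> {..n} \<Longrightarrow>
      lagrangian n (outer_degree lo hi) X \<le> lagrangian n (outer_degree lo hi) Y"
  shows "outer_levels lo hi X"
proof -
  define d where "d = outer_degree lo hi"
  have d: "hi \<le> d" "d = binom_partial hi (2 * hi - n)"
    using n binom_partial_ge_top[of "hi - lo" hi] by (auto simp: d_def outer_degree_def mult_2)
  have d': "0 < d" "2 \<le> d \<or> n \<le> 1" using d(1) n by linarith+
  from X d' opt[folded d_def] show ?thesis
  proof (rule minimizer_degrees)
    fix b assume b: "b \<le> n" "n - b \<le> b" "X = {n - b..b}" "binom_partial b (2 * b - n) \<le> d"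
      "b < n \<Longrightarrow> d \<le> binom_partial (b + 1) (2 * b + 1 - n)"
    have "b \<le> hi"
    proof (rule ccontr)
      assume "\<not> b \<le> hi"
      then have "d < binom_partial b (2 * b - n)"
        unfolding d(2) using n b by (intro binom_partial_less) auto
      then show False using b by simp
    qed
    moreover have "hi \<le> b"
    proof (rule ccontr)
      assume "\<not> hi \<le> b"
      then have "binom_partial (b + 1) (2 * b + 1 - n) < d"
        unfolding d(2) using n b by (intro binom_partial_less) auto
      then show False using b \<open>\<not> hi \<le> b\<close> n by simp
    qed
    ultimately have "b = hi" by simp
    moreover have "n - hi = lo" using n by simp
    ultimately show ?thesis using b(3) by (auto simp: outer_levels_def)
  next
    fix b assume b: "b \<le> n" "n - b < b" "X = {n - b<..b} \<or> X = {n - b..<b}"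
      "binom_partial b (2 * b - n - 1) \<le> d" "d \<le> binom_partial b (2 * b - n)"
    have "b \<le> hi"
    proof (rule ccontr)
      assume "\<not> b \<le> hi"
      then have "d < binom_partial b (2 * b - n - 1)"
        unfolding d(2) using n b by (intro binom_partial_less) auto
      then show False using b by simp
    qed
    moreover have "hi \<le> b"
    proof (rule ccontr)
      assume "\<not> hi \<le> b"
      then have "binom_partial b (2 * b - n) < d"
        unfolding d(2) using n b by (intro binom_partial_less) auto
      then show False using b by simp
    qed
    ultimately have "b = hi" by simp
    moreover have "n - hi = lo" using n by simp
    ultimately show ?thesis using b(3) by (auto simp: outer_levels_def)
  qed
qed

lemma lagrangian_inner_levels:
  assumes n: "lo + hi = n" "lo < hi" and X: "inner_levels lo hi X"
  shows "lagrangian n (inner_degree lo hi) X = lagrangian n (inner_degree lo hi) {lo<..<hi}"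
proof -
  have *: "{lo<..hi} = insert hi {Suc lo..<hi}" "{lo..<hi} = insert lo {lo<..hi - 1}"
      "{Suc lo..<hi} = {lo<..<hi}" "{lo<..hi - 1} = {lo<..<hi}"
    using n by auto
  have "lagrangian n (inner_degree lo hi) {lo<..hi} = lagrangian n (inner_degree lo hi) {lo<..<hi}"
    unfolding *(1) using n level_degree_top[of "Suc lo" hi n]
    by (subst lagrangian_insert) (auto simp: inner_degree_def *(3))
  moreover have "lagrangian n (inner_degree lo hi) {lo..<hi} = lagrangian n (inner_degree lo hi) {lo<..<hi}"
    unfolding *(2) using n level_degree_bottom[of n lo hi "hi - 1"]
    by (subst lagrangian_insert) (auto simp: inner_degree_def *(4)[simplified] diff_commute)
  ultimately show ?thesis using X by (auto simp: inner_levels_def)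
qed

lemma lagrangian_outer_levels:
  assumes n: "lo + hi = n" "lo < hi" and X: "outer_levels lo hi X"
  shows "lagrangian n (outer_degree lo hi) X = lagrangian n (outer_degree lo hi) {lo..hi}"
proof -
  have *: "{lo..hi} = insert hi {lo..<hi}" "{lo..hi} = insert lo {lo<..hi}"
    using n by auto
  have "lagrangian n (outer_degree lo hi) {lo..hi} = lagrangian n (outer_degree lo hi) {lo..<hi}"
    unfolding *(1) using n level_degree_top[of lo hi n]
    by (subst lagrangian_insert) (auto simp: outer_degree_def)
  moreover have "lagrangian n (outer_degree lo hi) {lo..hi} = lagrangian n (outer_degree lo hi) {lo<..hi}"
    unfolding *(2) using n level_degree_bottom[of n lo hi hi]
    by (subst lagrangian_insert) (auto simp: outer_degree_def)
  ultimately show ?thesis using X by (auto simp: outer_levels_def)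
qed

text \<open>Some minimiser exists, it satisfies \<open>inner_levels\<close>, and all sets doing so
  have the same Lagrangian. Hence all of them are minimisers, and there are no others.\<close>

lemma minimizers_inner:
  assumes n: "lo + hi = n" "lo + 2 \<le> hi"
  obtains v where
    "\<And>X. X \<subseteq> {..n} \<Longrightarrow> v \<le> lagrangian n (inner_degree lo hi) X"
    "\<And>X. X \<subseteq> {..n} \<Longrightarrow> lagrangian n (inner_degree lo hi) X = v \<longleftrightarrow> inner_levels lo hi X"
proof -
  obtain X0 where X0: "X0 \<subseteq> {..n}"
      "\<And>Y. Y \<subseteq> {..n} \<Longrightarrow> lagrangian n (inner_degree lo hi) X0 \<le> lagrangian n (inner_degree lo hi) Y"
    using lagrangian_minimizer_exists by blast
  have lt: "lo < hi" using n by simp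
  have "lagrangian n (inner_degree lo hi) X = lagrangian n (inner_degree lo hi) X0 \<longleftrightarrow>
      inner_levels lo hi X" if "X \<subseteq> {..n}" for X
    using minimizer_inner[OF n X0] minimizer_inner[OF n that] X0(2)
      lagrangian_inner_levels[OF n(1) lt] by metis
  then show thesis using that[of "lagrangian n (inner_degree lo hi) X0"] X0(2) by blast
qed

lemma minimizers_outer:
  assumes n: "lo + hi = n" "lo < hi"
  obtains v where
    "\<And>X. X \<subseteq> {..n} \<Longrightarrow> v \<le> lagrangian n (outer_degree lo hi) X"
    "\<And>X. X \<subseteq> {..n} \<Longrightarrow> lagrangian n (outer_degree lo hi) X = v \<longleftrightarrow> outer_levels lo hi X"
proof -
  obtain X0 where X0: "X0 \<subseteq> {..n}"
      "\<And>Y. Y \<subseteq> {..n} \<Longrightarrow> lagrangian n (outer_degree lo hi) X0 \<le> lagrangian n (outer_degree lo hi) Y"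
    using lagrangian_minimizer_exists by blast
  have "lagrangian n (outer_degree lo hi) X = lagrangian n (outer_degree lo hi) X0 \<longleftrightarrow>
      outer_levels lo hi X" if "X \<subseteq> {..n}" for X
    using minimizer_outer[OF n X0] minimizer_outer[OF n that] X0(2)
      lagrangian_outer_levels[OF n] by metis
  then show thesis using that[of "lagrangian n (outer_degree lo hi) X0"] X0(2) by blast
qed

subsection \<open>Averaging over maximal chains\<close>

text \<open>A permutation \<open>xs\<close> of the ground set encodes the maximal chain of the sets of its prefixes.\<close>

definition chain_levels :: "nat \<Rightarrow> 'a set set \<Rightarrow> 'a list \<Rightarrow> nat set" where
  "chain_levels n F xs = {i. i \<le> n \<and> set (take i xs) \<in> F}"

lemma card_set_take_permutation:
  assumes "xs \<in> permutations_of_set S" "i \<le> card S"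
  shows "card (set (take i xs)) = i"
  using assms length_finite_permutations_of_set[OF assms(1)] permutations_of_setD[OF assms(1)]
  by (simp add: distinct_card)

lemma permutations_with_prefix:
  assumes "finite S" "A \<subseteq> S"
  shows "{xs \<in> permutations_of_set S. set (take (card A) xs) = A} =
    (\<lambda>(us, vs). us @ vs) ` (permutations_of_set A \<times> permutations_of_set (S - A))"
proof (intro equalityI subsetI)
  fix xs assume "xs \<in> {xs \<in> permutations_of_set S. set (take (card A) xs) = A}"
  then have xs: "set xs = S" "distinct xs" "set (take (card A) xs) = A"
    by (auto dest: permutations_of_setD)
  have "set (take (card A) xs) \<inter> set (drop (card A) xs) = {}"
    using xs(2) by (intro set_take_disj_set_drop_if_distinct) auto
  then have "set (drop (card A) xs) = S - A"
    using xs set_append[of "take (card A) xs" "drop (card A) xs"] by auto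
  then show "xs \<in> (\<lambda>(us, vs). us @ vs) ` (permutations_of_set A \<times> permutations_of_set (S - A))"
    using xs by (intro image_eqI[of _ _ "(take (card A) xs, drop (card A) xs)"]) auto
next
  fix xs assume "xs \<in> (\<lambda>(us, vs). us @ vs) ` (permutations_of_set A \<times> permutations_of_set (S - A))"
  then obtain us vs where *: "xs = us @ vs" "us \<in> permutations_of_set A" "vs \<in> permutations_of_set (S - A)"
    by auto
  then have "length us = card A" by (simp add: length_finite_permutations_of_set)
  then show "xs \<in> {xs \<in> permutations_of_set S. set (take (card A) xs) = A}"
    using * assms permutations_of_setD[OF *(2)] permutations_of_setD[OF *(3)]
    by (auto intro!: permutations_of_setI)
qed

text \<open>The cut is determined, as every first component has length
  \<open>card A\<close>.\<close>

lemma inj_on_append_permutations: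
  "inj_on (\<lambda>(us, vs). us @ vs) (permutations_of_set A \<times> P)"
  by (rule inj_onI) (auto simp: length_finite_permutations_of_set dest: append_eq_append_conv[THEN iffD1, rotated])

lemma card_permutations_with_prefix:
  assumes "finite S" "A \<subseteq> S"
  shows "card {xs \<in> permutations_of_set S. set (take (card A) xs) = A} =
    fact (card A) * fact (card S - card A)"
  unfolding permutations_with_prefix[OF assms] card_image[OF inj_on_append_permutations]
  using assms by (simp add: card_cartesian_product finite_subset card_Diff_subset)

text \<open>Cut off the prefix enumerating \<open>B\<close>, then cut that prefix at
  \<open>A\<close>; the three pieces are permuted independently.\<close>

lemma card_permutations_with_two_prefixes:
  assumes "finite S" "A \<subseteq> B" "B \<subseteq> S"
  shows "card {xs \<in> permutations_of_set S. set (take (card A) xs) = A \<and> set (take (card B) xs) = B} =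
    fact (card A) * fact (card B - card A) * fact (card S - card B)"
proof -
  have fin: "finite B" using assms finite_subset by blast
  have AB: "card A \<le> card B" using fin assms card_mono by blast
  have "{xs \<in> permutations_of_set S. set (take (card A) xs) = A \<and> set (take (card B) xs) = B} =
    {xs \<in> {xs \<in> permutations_of_set S. set (take (card B) xs) = B}. set (take (card A) xs) = A}"
    by auto
  also have "\<dots> = (\<lambda>(us, vs). us @ vs) `
      ({us \<in> permutations_of_set B. set (take (card A) us) = A} \<times> permutations_of_set (S - B))"
    (is "?L = ?R")
  proof -
    have "set (take (card A) (us @ vs)) = set (take (card A) us)"
      if "us \<in> permutations_of_set B" for us vs
      using AB that by (simp add: length_finite_permutations_of_set)
    then show ?thesis
      unfolding permutations_with_prefix[OF assms(1,3)] by fastforce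
  qed
  finally have "card {xs \<in> permutations_of_set S. set (take (card A) xs) = A \<and> set (take (card B) xs) = B} =
      card ({us \<in> permutations_of_set B. set (take (card A) us) = A} \<times> permutations_of_set (S - B))"
    by (simp only:) (intro card_image inj_on_subset[OF inj_on_append_permutations], auto)
  then show ?thesis
    using card_permutations_with_prefix[OF fin assms(2)] assms fin
    by (simp add: card_cartesian_product card_Diff_subset)
qed

lemma sum_swap_card:
  fixes w :: "'b \<Rightarrow> nat"
  assumes "finite P" "finite Q"
  shows "(\<Sum>x\<in>P. \<Sum>y | y \<in> Q \<and> R x y. w y) = (\<Sum>y\<in>Q. card {x \<in> P. R x y} * w y)"
  by (subst sum.swap_restrict[OF assms]) simp

text \<open>A set \<open>A\<close> lies on \<open>fact (card A) * fact (n - card A)\<close> of the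
  chains, and the weight \<open>n choose card A\<close> completes this to \<open>fact n\<close>.
  Summing over permutations instead of averaging avoids fractions.\<close>

lemma sum_level_weight:
  assumes "finite S" "F \<subseteq> Pow S" "card S = n"
  shows "(\<Sum>xs\<in>permutations_of_set S. level_weight n (chain_levels n F xs)) = fact n * card F"
proof -
  have fin: "finite F" using assms finite_subset by blast
  have "level_weight n (chain_levels n F xs) =
      (\<Sum>A | A \<in> F \<and> set (take (card A) xs) = A. n choose card A)"
    if xs: "xs \<in> permutations_of_set S" for xs
    unfolding level_weight_def
  \<comment> \<open>Along one chain, a level and the member found there determine each
    other.\<close>
  proof (rule sum.reindex_bij_witness[of _ card "\<lambda>i. set (take i xs)"])
    fix i assume "i \<in> chain_levels n F xs"
    then show "card (set (take i xs)) = i"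
      "set (take i xs) \<in> {A \<in> F. set (take (card A) xs) = A}"
      "n choose card (set (take i xs)) = n choose i"
      using card_set_take_permutation[OF xs] assms(3) by (auto simp: chain_levels_def)
  next
    fix A assume "A \<in> {A \<in> F. set (take (card A) xs) = A}"
    moreover from this have "card A \<le> n"
      using assms card_mono[OF assms(1), of A] by auto
    ultimately show "set (take (card A) xs) = A" "card A \<in> chain_levels n F xs"
      by (auto simp: chain_levels_def)
  qed
  then have "(\<Sum>xs\<in>permutations_of_set S. level_weight n (chain_levels n F xs)) =
      (\<Sum>xs\<in>permutations_of_set S. \<Sum>A | A \<in> F \<and> set (take (card A) xs) = A. n choose card A)"
    by (rule sum.cong[OF refl])
  also have "\<dots> = (\<Sum>A\<in>F. card {xs \<in> permutations_of_set S. set (take (card A) xs) = A} * (n choose card A))"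
    using fin by (intro sum_swap_card) auto
  also have "\<dots> = (\<Sum>A\<in>F. fact n)"
  proof (rule sum.cong[OF refl])
    fix A assume "A \<in> F"
    then have "A \<subseteq> S" "card A \<le> n" using assms card_mono[OF assms(1), of A] by auto
    then show "card {xs \<in> permutations_of_set S. set (take (card A) xs) = A} * (n choose card A) = fact n"
      using card_permutations_with_prefix[OF assms(1), of A] assms(3) binomial_fact_lemma[of "card A" n]
      by (simp add: mult_ac)
  qed
  finally show ?thesis by simp
qed

lemma finite_two_chains: "finite F \<Longrightarrow> finite (two_chains F)"
  by (rule finite_subset[of _ "F \<times> F"]) (auto simp: two_chains_def)

lemma sum_level_chains:
  assumes "finite S" "F \<subseteq> Pow S" "card S = n"
  shows "(\<Sum>xs\<in>permutations_of_set S. level_chains n (chain_levels n F xs)) =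
    fact n * card (two_chains F)"
proof -
  have fin: "finite F" using assms finite_subset by blast
  define R where "R xs = (\<lambda>(A :: 'a set, B). set (take (card A) xs) = A \<and> set (take (card B) xs) = B)" for xs
  define w where "w = (\<lambda>(A :: 'a set, B :: 'a set). (n choose card B) * (card B choose card A))"
  have "level_chains n (chain_levels n F xs) = (\<Sum>p | p \<in> two_chains F \<and> R xs p. w p)"
    if xs: "xs \<in> permutations_of_set S" for xs
    unfolding level_chains_def
  proof (rule sum.reindex_bij_witness[of _ "\<lambda>(A, B). (card A, card B)" "\<lambda>(i, j). (set (take i xs), set (take j xs))"])
    fix p assume "p \<in> {(i, j). i \<in> chain_levels n F xs \<and> j \<in> chain_levels n F xs \<and> i < j}"
    then obtain i j where p: "p = (i, j)" "i < j" "j \<le> n" "set (take i xs) \<in> F" "set (take j xs) \<in> F"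
      by (auto simp: chain_levels_def)
    have card: "card (set (take i xs)) = i" "card (set (take j xs)) = j"
      using card_set_take_permutation[OF xs] assms(3) p by auto
    moreover have "set (take i xs) \<subset> set (take j xs)"
      using set_take_subset_set_take[of i j xs] p card by (auto simp: psubset_eq)
    ultimately show
      "(case case p of (i, j) \<Rightarrow> (set (take i xs), set (take j xs)) of (A, B) \<Rightarrow> (card A, card B)) = p"
      "(case p of (i, j) \<Rightarrow> (set (take i xs), set (take j xs))) \<in> {p \<in> two_chains F. R xs p}"
      "w (case p of (i, j) \<Rightarrow> (set (take i xs), set (take j xs))) =
        (case p of (i, j) \<Rightarrow> (n choose j) * (j choose i))"
      using p by (auto simp: two_chains_def R_def w_def)
  next
    fix p assume "p \<in> {p \<in> two_chains F. R xs p}"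
    then obtain A B where p: "p = (A, B)" "A \<in> F" "B \<in> F" "A \<subset> B"
        "set (take (card A) xs) = A" "set (take (card B) xs) = B"
      by (auto simp: two_chains_def R_def)
    have "card B \<le> n" "card A \<le> n"
      using p assms(2) card_mono[OF assms(1)] unfolding assms(3)[symmetric] by auto
    moreover have "card A < card B"
      using p assms by (intro psubset_card_mono) (auto intro: finite_subset)
    ultimately show "(case p of (A, B) \<Rightarrow> (card A, card B)) \<in>
        {(i, j). i \<in> chain_levels n F xs \<and> j \<in> chain_levels n F xs \<and> i < j}"
      "(case case p of (A, B) \<Rightarrow> (card A, card B) of (i, j) \<Rightarrow> (set (take i xs), set (take j xs))) = p"
      using p by (auto simp: chain_levels_def)
  qed
  then have "(\<Sum>xs\<in>permutations_of_set S. level_chains n (chain_levels n F xs)) =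
      (\<Sum>xs\<in>permutations_of_set S. \<Sum>p | p \<in> two_chains F \<and> R xs p. w p)"
    by (rule sum.cong[OF refl])
  also have "\<dots> = (\<Sum>p\<in>two_chains F. card {xs \<in> permutations_of_set S. R xs p} * w p)"
    using fin by (intro sum_swap_card) (auto intro: finite_two_chains)
  also have "\<dots> = (\<Sum>p\<in>two_chains F. fact n)"
  proof (rule sum.cong[OF refl])
    fix p assume "p \<in> two_chains F"
    then obtain A B where p: "p = (A, B)" "A \<subseteq> B" "B \<subseteq> S"
      using assms by (auto simp: two_chains_def)
    have "finite B" using p assms finite_subset by blast
    then have AB: "card A \<le> card B" "card B \<le> n"
      using p card_mono[of B A] card_mono[OF assms(1), of B] assms(3) by auto
    \<comment> \<open>The grouping lets the factorial identity apply twice: the bracket is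
      \<open>fact (card B)\<close>, and then the whole product is \<open>fact n\<close>.\<close>
    have "card {xs \<in> permutations_of_set S. R xs p} * w p =
        (fact (card A) * fact (card B - card A) * (card B choose card A)) * fact (n - card B) * (n choose card B)"
      using card_permutations_with_two_prefixes[OF assms(1) p(2,3)] p(1) assms(3)
      by (simp add: R_def w_def)
    also have "\<dots> = fact n"
      by (simp only: binomial_fact_lemma AB)
    finally show "card {xs \<in> permutations_of_set S. R xs p} * w p = fact n" .
  qed
  finally show ?thesis by simp
qed

lemma sum_lagrangian:
  assumes "finite S" "F \<subseteq> Pow S" "card S = n"
  shows "(\<Sum>xs\<in>permutations_of_set S. lagrangian n d (chain_levels n F xs)) =
    fact n * (int (card (two_chains F)) - int d * int (card F))"
  using sum_level_weight[OF assms, THEN arg_cong[of _ _ int]]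
    sum_level_chains[OF assms, THEN arg_cong[of _ _ int]]
  by (simp add: lagrangian_def sum_subtractf sum_distrib_left[symmetric] algebra_simps)

subsection \<open>Extremal families\<close>

text \<open>The number of such permutations is a product of factorials, hence positive. Taking
  \<open>A = B\<close> gives a chain through a single set.\<close>

lemma permutation_through_chain:
  assumes "finite S" "A \<subseteq> B" "B \<subseteq> S"
  obtains xs where "xs \<in> permutations_of_set S" "set (take (card A) xs) = A" "set (take (card B) xs) = B"
proof -
  have "card {xs \<in> permutations_of_set S. set (take (card A) xs) = A \<and> set (take (card B) xs) = B} \<noteq> 0"
    by (simp add: card_permutations_with_two_prefixes[OF assms])
  then have "{xs \<in> permutations_of_set S. set (take (card A) xs) = A \<and> set (take (card B) xs) = B} \<noteq> {}"
    by fastforce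
  then show thesis using that by blast
qed

lemma two_chains_mono: "F \<subseteq> G \<Longrightarrow> two_chains F \<subseteq> two_chains G"
  by (auto simp: two_chains_def)

lemma antichain_subset: "antichain G \<Longrightarrow> F \<subseteq> G \<Longrightarrow> antichain F"
  using two_chains_mono unfolding antichain_def by blast

lemma antichain_uniform:
  assumes "\<And>A. A \<in> F \<Longrightarrow> finite A \<and> card A = k"
  shows "antichain F"
proof -
  have "\<not> A \<subset> B" if "A \<in> F" "B \<in> F" for A B
    using psubset_card_mono[of B A] assms[OF that(1)] assms[OF that(2)] by auto
  then show ?thesis unfolding antichain_def two_chains_def by blast
qed

text \<open>Sets of equal size are never properly nested, so only pairs across the two layers
  matter. \<open>P\<close> serves both for membership in the family and for its negation.\<close>

lemma antichain_two_layers: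
  assumes "finite S" "lo < hi"
  shows "antichain {A. A \<subseteq> S \<and> P A \<and> (card A = lo \<or> card A = hi)} \<longleftrightarrow>
    (\<forall>A B. A \<subset> B \<and> B \<subseteq> S \<and> card A = lo \<and> card B = hi \<longrightarrow> \<not> (P A \<and> P B))"
proof -
  have "card A < card B" if "A \<subset> B" "B \<subseteq> S" for A B
    using that assms(1) by (meson finite_subset psubset_card_mono)
  then have cards: "card A = lo \<and> card B = hi"
    if "A \<subset> B" "B \<subseteq> S" "card A = lo \<or> card A = hi" "card B = lo \<or> card B = hi" for A B
    using that assms(2) by (metis less_asym less_irrefl)
  show ?thesis (is "antichain ?F \<longleftrightarrow> ?R")
  proof
    assume "antichain ?F"
    then have *: "\<not> A \<subset> B" if "A \<in> ?F" "B \<in> ?F" for A B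
      using that unfolding antichain_def two_chains_def by blast
    show ?R
    proof (intro allI impI)
      fix A B assume "A \<subset> B \<and> B \<subseteq> S \<and> card A = lo \<and> card B = hi"
      then show "\<not> (P A \<and> P B)" using *[of A B] by auto
    qed
  next
    assume R: ?R
    have "\<not> A \<subset> B" if "A \<in> ?F" "B \<in> ?F" for A B
      using that R cards[of A B] by blast
    then show "antichain ?F" unfolding antichain_def two_chains_def by blast
  qed
qed

lemma card_layers:
  assumes "finite S" "finite T"
  shows "card {A. A \<subseteq> S \<and> card A \<in> T} = (\<Sum>i\<in>T. card S choose i)"
proof -
  have "{A. A \<subseteq> S \<and> card A \<in> T} = (\<Union>i\<in>T. {A. A \<subseteq> S \<and> card A = i})" by auto
  also have "card \<dots> = (\<Sum>i\<in>T. card {A. A \<subseteq> S \<and> card A = i})"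
    using assms by (intro card_UN_disjoint) auto
  finally show ?thesis using n_subsets[OF assms(1)] by simp
qed

text \<open>Provides the families that attain the lower bound: full layers, with the remaining sets
  drawn from the single layer \<open>k\<close>.\<close>

lemma ex_layered_family:
  assumes S: "finite S" and T: "finite T" "k \<notin> T"
    and s: "(\<Sum>i\<in>T. card S choose i) \<le> s" "s \<le> (\<Sum>i\<in>insert k T. card S choose i)"
  obtains G where "{A. A \<subseteq> S \<and> card A \<in> T} \<subseteq> G"
    "G \<subseteq> {A. A \<subseteq> S \<and> card A \<in> insert k T}" "card G = s"
proof -
  define L where "L = {A. A \<subseteq> S \<and> card A \<in> T}"
  have L: "finite L" "card L = (\<Sum>i\<in>T. card S choose i)"
    using S T(1) by (auto simp: L_def card_layers)
  have "s - card L \<le> card {A. A \<subseteq> S \<and> card A = k}"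
    using s(2) T by (simp add: L n_subsets[OF S])
  then obtain H where H: "H \<subseteq> {A. A \<subseteq> S \<and> card A = k}" "card H = s - card L" "finite H"
    using obtain_subset_with_card_n by blast
  have "L \<inter> H = {}" using H(1) T(2) by (auto simp: L_def)
  then have "card (L \<union> H) = s" using L H s(1) by (simp add: card_Un_disjoint)
  then show thesis using that[of "L \<union> H"] H(1) by (auto simp: L_def)
qed

lemma levels_between_cases:
  fixes lo hi :: nat
  assumes "lo < hi" and X: "X \<subseteq> {lo..hi}" "{lo<..<hi} \<subseteq> X"
  shows "lo \<notin> X \<and> hi \<notin> X \<and> X = {lo<..<hi} \<or> lo \<in> X \<and> hi \<notin> X \<and> X = {lo..<hi} \<or>
    lo \<notin> X \<and> hi \<in> X \<and> X = {lo<..hi} \<or> lo \<in> X \<and> hi \<in> X \<and> X = {lo..hi}"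
proof -
  have ivls: "{lo<..<hi} \<union> {lo, hi} = {lo..hi}" "{lo<..<hi} \<union> {lo} = {lo..<hi}"
      "{lo<..<hi} \<union> {hi} = {lo<..hi}"
    using assms(1) by auto
  have "X \<subseteq> {lo<..<hi} \<union> {lo, hi}" unfolding ivls(1) by (rule X(1))
  then have X_eq: "X = {lo<..<hi} \<union> (X \<inter> {lo, hi})" using X(2) by blast
  consider "lo \<notin> X" "hi \<notin> X" "X \<inter> {lo, hi} = {}" | "lo \<in> X" "hi \<notin> X" "X \<inter> {lo, hi} = {lo}"
    | "lo \<notin> X" "hi \<in> X" "X \<inter> {lo, hi} = {hi}" | "lo \<in> X" "hi \<in> X" "X \<inter> {lo, hi} = {lo, hi}"
    by (cases "lo \<in> X"; cases "hi \<in> X") auto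
  then show ?thesis
  proof cases
    case 1 then show ?thesis using X_eq by (metis sup_bot_right)
  next
    case 2 then show ?thesis using X_eq ivls(2) by metis
  next
    case 3 then show ?thesis using X_eq ivls(3) by metis
  next
    case 4 then show ?thesis using X_eq ivls(1) by metis
  qed
qed

section \<open>Reading conditions (1) to (4) off the maximal chains\<close>

lemma inner_levels_iff:
  assumes "lo < hi"
  shows "inner_levels lo hi X \<longleftrightarrow> X \<subseteq> {lo..hi} \<and> {lo<..<hi} \<subseteq> X \<and> \<not> (lo \<in> X \<and> hi \<in> X)"
proof
  assume "X \<subseteq> {lo..hi} \<and> {lo<..<hi} \<subseteq> X \<and> \<not> (lo \<in> X \<and> hi \<in> X)"
  then have X: "X \<subseteq> {lo..hi}" "{lo<..<hi} \<subseteq> X" "\<not> (lo \<in> X \<and> hi \<in> X)" by auto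
  show "inner_levels lo hi X"
    using levels_between_cases[OF assms X(1,2)] X(3) unfolding inner_levels_def by argo
qed (use assms in \<open>auto simp: inner_levels_def\<close>)

lemma outer_levels_iff:
  assumes "lo < hi"
  shows "outer_levels lo hi X \<longleftrightarrow> X \<subseteq> {lo..hi} \<and> {lo<..<hi} \<subseteq> X \<and> (lo \<in> X \<or> hi \<in> X)"
proof
  assume "X \<subseteq> {lo..hi} \<and> {lo<..<hi} \<subseteq> X \<and> (lo \<in> X \<or> hi \<in> X)"
  then have X: "X \<subseteq> {lo..hi}" "{lo<..<hi} \<subseteq> X" "lo \<in> X \<or> hi \<in> X" by auto
  show "outer_levels lo hi X"
    using levels_between_cases[OF assms X(1,2)] X(3) unfolding outer_levels_def by argo
qed (use assms in \<open>auto simp: outer_levels_def\<close>)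

text \<open>Every member lies on some maximal chain, at the level given by its size.\<close>

lemma all_chain_levels_bounds:
  assumes S: "finite S" "card S = n" and F: "F \<subseteq> Pow S"
  shows "(\<forall>xs\<in>permutations_of_set S. chain_levels n F xs \<subseteq> {lo..hi}) \<longleftrightarrow>
    (\<forall>A\<in>F. lo \<le> card A \<and> card A \<le> hi)"
proof (intro iffI ballI subsetI)
  fix A assume *: "\<forall>xs\<in>permutations_of_set S. chain_levels n F xs \<subseteq> {lo..hi}" "A \<in> F"
  then have "A \<subseteq> S" using F by auto
  then obtain xs where "xs \<in> permutations_of_set S" "set (take (card A) xs) = A"
    using permutation_through_chain[OF S(1), of A A] by auto
  moreover have "card A \<le> n" using card_mono[OF S(1) \<open>A \<subseteq> S\<close>] S(2) by simp
  ultimately show "lo \<le> card A \<and> card A \<le> hi" using * by (fastforce simp: chain_levels_def)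
next
  fix xs i assume "\<forall>A\<in>F. lo \<le> card A \<and> card A \<le> hi" "xs \<in> permutations_of_set S" "i \<in> chain_levels n F xs"
  then show "i \<in> {lo..hi}"
    using card_set_take_permutation[of xs S i] S(2) by (auto simp: chain_levels_def)
qed

lemma all_chain_levels_middle:
  assumes S: "finite S" "card S = n" and "hi \<le> n"
  shows "(\<forall>xs\<in>permutations_of_set S. {lo<..<hi} \<subseteq> chain_levels n F xs) \<longleftrightarrow>
    (\<forall>A. A \<subseteq> S \<and> lo < card A \<and> card A < hi \<longrightarrow> A \<in> F)"
proof (intro iffI allI ballI impI subsetI)
  fix A assume *: "\<forall>xs\<in>permutations_of_set S. {lo<..<hi} \<subseteq> chain_levels n F xs"
    "A \<subseteq> S \<and> lo < card A \<and> card A < hi"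
  then obtain xs where "xs \<in> permutations_of_set S" "set (take (card A) xs) = A"
    using permutation_through_chain[OF S(1), of A A] by auto
  then show "A \<in> F" using * by (fastforce simp: chain_levels_def)
next
  fix xs i assume *: "\<forall>A. A \<subseteq> S \<and> lo < card A \<and> card A < hi \<longrightarrow> A \<in> F"
    "xs \<in> permutations_of_set S" "i \<in> {lo<..<hi}"
  then have "card (set (take i xs)) = i" "set (take i xs) \<subseteq> S"
    using card_set_take_permutation[of xs S i] S(2) assms(3) permutations_of_setD[of xs S]
    by (auto dest: in_set_takeD)
  then show "i \<in> chain_levels n F xs" using * assms(3) by (auto simp: chain_levels_def)
qed

text \<open>Every nested pair from the two layers lies on a common chain, and every chain supplies
  one such pair. \<open>Q\<close> becomes "not both" for condition (3) and "at least one" for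
  condition (4).\<close>

lemma all_chain_levels_ends:
  assumes S: "finite S" "card S = n" and "lo < hi" "hi \<le> n"
  shows "(\<forall>xs\<in>permutations_of_set S. Q (lo \<in> chain_levels n F xs) (hi \<in> chain_levels n F xs)) \<longleftrightarrow>
    (\<forall>A B. A \<subset> B \<and> B \<subseteq> S \<and> card A = lo \<and> card B = hi \<longrightarrow> Q (A \<in> F) (B \<in> F))"
proof (intro iffI allI ballI impI)
  fix A B assume *: "\<forall>xs\<in>permutations_of_set S. Q (lo \<in> chain_levels n F xs) (hi \<in> chain_levels n F xs)"
    "A \<subset> B \<and> B \<subseteq> S \<and> card A = lo \<and> card B = hi"
  then obtain xs where "xs \<in> permutations_of_set S" "set (take lo xs) = A" "set (take hi xs) = B"
    using permutation_through_chain[OF S(1), of A B] by auto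
  then show "Q (A \<in> F) (B \<in> F)" using * assms(3,4) by (auto simp: chain_levels_def)
next
  fix xs assume *: "\<forall>A B. A \<subset> B \<and> B \<subseteq> S \<and> card A = lo \<and> card B = hi \<longrightarrow> Q (A \<in> F) (B \<in> F)"
    "xs \<in> permutations_of_set S"
  then have card: "card (set (take lo xs)) = lo" "card (set (take hi xs)) = hi"
    using card_set_take_permutation[OF *(2)] S(2) assms(3,4) by simp_all
  moreover have "set (take lo xs) \<subset> set (take hi xs)"
    using card set_take_subset_set_take[of lo hi xs] assms(3) by (auto simp: psubset_eq)
  moreover have "set (take hi xs) \<subseteq> S"
    using permutations_of_setD[OF *(2)] by (auto dest: in_set_takeD)
  ultimately show "Q (lo \<in> chain_levels n F xs) (hi \<in> chain_levels n F xs)"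
    using * assms(3,4) by (auto simp: chain_levels_def)
qed

lemma all_chain_levels_inner:
  assumes S: "finite S" "card S = n" and F: "F \<subseteq> Pow S" and "lo < hi" "hi \<le> n"
  shows "(\<forall>xs\<in>permutations_of_set S. inner_levels lo hi (chain_levels n F xs)) \<longleftrightarrow>
    (\<forall>A\<in>F. lo \<le> card A \<and> card A \<le> hi) \<and> (\<forall>A. A \<subseteq> S \<and> lo < card A \<and> card A < hi \<longrightarrow> A \<in> F) \<and>
    antichain {A \<in> F. card A = lo \<or> card A = hi}"
proof -
  have "{A \<in> F. card A = lo \<or> card A = hi} = {A. A \<subseteq> S \<and> A \<in> F \<and> (card A = lo \<or> card A = hi)}"
    using F by auto
  then show ?thesis
    using all_chain_levels_ends[OF S assms(4,5), of "\<lambda>p q. \<not> (p \<and> q)" F]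
      antichain_two_layers[OF S(1) assms(4), of "\<lambda>A. A \<in> F"]
    unfolding inner_levels_iff[OF assms(4)] ball_conj_distrib
      all_chain_levels_bounds[OF S F] all_chain_levels_middle[OF S assms(5)]
    by simp
qed

lemma all_chain_levels_outer:
  assumes S: "finite S" "card S = n" and F: "F \<subseteq> Pow S" and "lo < hi" "hi \<le> n"
  shows "(\<forall>xs\<in>permutations_of_set S. outer_levels lo hi (chain_levels n F xs)) \<longleftrightarrow>
    (\<forall>A\<in>F. lo \<le> card A \<and> card A \<le> hi) \<and> (\<forall>A. A \<subseteq> S \<and> lo < card A \<and> card A < hi \<longrightarrow> A \<in> F) \<and>
    antichain {A. A \<subseteq> S \<and> A \<notin> F \<and> (card A = lo \<or> card A = hi)}"
  using all_chain_levels_ends[OF S assms(4,5), of "\<lambda>p q. p \<or> q" F]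
    antichain_two_layers[OF S(1) assms(4), of "\<lambda>A. A \<notin> F"]
  unfolding outer_levels_iff[OF assms(4)] ball_conj_distrib
    all_chain_levels_bounds[OF S F] all_chain_levels_middle[OF S assms(5)]
  by simp

text \<open>For families of the given size the multiplier term is constant, so the excesses over
  \<open>v\<close>, summed over all chains, are \<open>fact n\<close> times the excess of the number
  of 2-chains over \<open>m\<close>. Each excess is nonnegative and \<open>G\<close> has total 0, so
  minimality means that every single excess vanishes.\<close>

lemma minimizes_iff_chain_levels:
  assumes F: "F \<subseteq> Pow {1..n}" and G: "G \<subseteq> Pow {1..n}" "card G = card F"
    and G_opt: "\<And>xs. xs \<in> permutations_of_set {1..n} \<Longrightarrow> Opt (chain_levels n G xs)"
    and ge: "\<And>X. X \<subseteq> {..n} \<Longrightarrow> v \<le> lagrangian n d X"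
    and eq: "\<And>X. X \<subseteq> {..n} \<Longrightarrow> lagrangian n d X = v \<longleftrightarrow> Opt X"
  shows "minimizes_two_chains n F \<longleftrightarrow> (\<forall>xs\<in>permutations_of_set {1..n}. Opt (chain_levels n F xs))"
proof -
  define m where "m = v + int d * int (card F)"
  have sub: "chain_levels n H xs \<subseteq> {..n}" for H :: "nat set set" and xs
    by (auto simp: chain_levels_def)
  have sum: "(\<Sum>xs\<in>permutations_of_set {1..n}. lagrangian n d (chain_levels n H xs) - v) =
      fact n * (int (card (two_chains H)) - m)"
    if "H \<subseteq> Pow {1..n}" "card H = card F" for H
    using sum_lagrangian[of "{1..n}" H n d] that
    by (simp add: sum_subtractf m_def algebra_simps)
  have lower: "m \<le> int (card (two_chains H))" if "H \<subseteq> Pow {1..n}" "card H = card F" for H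
  proof -
    have "0 \<le> fact n * (int (card (two_chains H)) - m)"
      unfolding sum[OF that, symmetric] using ge[OF sub] by (intro sum_nonneg) auto
    moreover have "(0::int) < fact n" by simp
    ultimately show ?thesis by (simp add: zero_le_mult_iff)
  qed
  have tight: "int (card (two_chains H)) = m \<longleftrightarrow>
      (\<forall>xs\<in>permutations_of_set {1..n}. Opt (chain_levels n H xs))"
    if "H \<subseteq> Pow {1..n}" "card H = card F" for H
  proof -
    have "int (card (two_chains H)) = m \<longleftrightarrow> fact n * (int (card (two_chains H)) - m) = 0" by simp
    also have "\<dots> \<longleftrightarrow> (\<forall>xs\<in>permutations_of_set {1..n}. lagrangian n d (chain_levels n H xs) - v = 0)"
      unfolding sum[OF that, symmetric] using ge[OF sub] by (intro sum_nonneg_eq_0_iff) auto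
    finally show ?thesis using eq[OF sub] by simp
  qed
  have "int (card (two_chains G)) = m" using tight[OF G] G_opt by simp
  then have "minimizes_two_chains n F \<longleftrightarrow> int (card (two_chains F)) = m"
    using lower F G unfolding minimizes_two_chains_def by (metis antisym nle_le of_nat_le_iff)
  then show ?thesis using tight[OF F] by simp
qed

text \<open>The comparison family \<open>G\<close> fills the layers strictly between and puts its
  other sets into layer \<open>lo\<close>, so its sets at the ends have equal size and form an
  antichain.\<close>

lemma minimizes_iff_inner:
  assumes n: "lo + hi = n" "lo + 2 \<le> hi" and F: "F \<subseteq> Pow {1..n}"
    and s: "(\<Sum>i\<in>{lo<..<hi}. n choose i) \<le> card F" "card F \<le> (\<Sum>i\<in>{lo..<hi}. n choose i)"
  shows "minimizes_two_chains n F \<longleftrightarrow>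
    (\<forall>A\<in>F. lo \<le> card A \<and> card A \<le> hi) \<and>
    (\<forall>A. A \<subseteq> {1..n} \<and> lo < card A \<and> card A < hi \<longrightarrow> A \<in> F) \<and>
    antichain {A \<in> F. card A = lo \<or> card A = hi}"
proof -
  have ins: "insert lo {lo<..<hi} = {lo..<hi}" using n by auto
  have lt: "lo < hi" "hi \<le> n" using n by auto
  obtain G where G: "{A. A \<subseteq> {1..n} \<and> card A \<in> {lo<..<hi}} \<subseteq> G"
      "G \<subseteq> {A. A \<subseteq> {1..n} \<and> card A \<in> {lo..<hi}}" "card G = card F"
    using ex_layered_family[of "{1..n}" "{lo<..<hi}" lo "card F"] s unfolding ins by auto
  have sub: "G \<subseteq> Pow {1..n}" using G(2) by auto
  have fin: "finite A" if "A \<in> G" for A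
    using that sub finite_subset[of A "{1..n}"] by blast
  have "antichain {A \<in> G. card A = lo \<or> card A = hi}"
    using G(2) fin by (intro antichain_uniform[of _ lo]) auto
  then have "\<forall>xs\<in>permutations_of_set {1..n}. inner_levels lo hi (chain_levels n G xs)"
    using G all_chain_levels_inner[OF _ _ sub lt] by fastforce
  moreover obtain v where v:
    "\<And>X. X \<subseteq> {..n} \<Longrightarrow> v \<le> lagrangian n (inner_degree lo hi) X"
    "\<And>X. X \<subseteq> {..n} \<Longrightarrow> lagrangian n (inner_degree lo hi) X = v \<longleftrightarrow> inner_levels lo hi X"
    using minimizers_inner[OF n] by blast
  ultimately have "minimizes_two_chains n F \<longleftrightarrow>
      (\<forall>xs\<in>permutations_of_set {1..n}. inner_levels lo hi (chain_levels n F xs))"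
    using minimizes_iff_chain_levels[OF F sub G(3) _ v] by blast
  then show ?thesis using all_chain_levels_inner[OF _ _ F lt] by simp
qed

text \<open>Here \<open>G\<close> fills the layers from \<open>lo\<close> to \<open>hi - 1\<close>
  and takes the rest from layer \<open>hi\<close>, so the sets it misses at the ends have equal
  size.\<close>

lemma minimizes_iff_outer:
  assumes n: "lo + hi = n" "lo < hi" and F: "F \<subseteq> Pow {1..n}"
    and s: "(\<Sum>i\<in>{lo..<hi}. n choose i) \<le> card F" "card F \<le> (\<Sum>i\<in>{lo..hi}. n choose i)"
  shows "minimizes_two_chains n F \<longleftrightarrow>
    (\<forall>A\<in>F. lo \<le> card A \<and> card A \<le> hi) \<and>
    (\<forall>A. A \<subseteq> {1..n} \<and> lo < card A \<and> card A < hi \<longrightarrow> A \<in> F) \<and>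
    antichain {A. A \<subseteq> {1..n} \<and> A \<notin> F \<and> (card A = lo \<or> card A = hi)}"
proof -
  have ins: "insert hi {lo..<hi} = {lo..hi}" using n by auto
  have lt: "lo < hi" "hi \<le> n" using n by auto
  obtain G where G: "{A. A \<subseteq> {1..n} \<and> card A \<in> {lo..<hi}} \<subseteq> G"
      "G \<subseteq> {A. A \<subseteq> {1..n} \<and> card A \<in> {lo..hi}}" "card G = card F"
    using ex_layered_family[of "{1..n}" "{lo..<hi}" hi "card F"] s unfolding ins by auto
  have sub: "G \<subseteq> Pow {1..n}" using G(2) by auto
  have "antichain {A. A \<subseteq> {1..n} \<and> A \<notin> G \<and> (card A = lo \<or> card A = hi)}"
    using G(1) lt by (intro antichain_uniform[of _ hi]) (auto intro: finite_subset)
  then have "\<forall>xs\<in>permutations_of_set {1..n}. outer_levels lo hi (chain_levels n G xs)"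
    using G all_chain_levels_outer[OF _ _ sub lt] by fastforce
  moreover obtain v where v:
    "\<And>X. X \<subseteq> {..n} \<Longrightarrow> v \<le> lagrangian n (outer_degree lo hi) X"
    "\<And>X. X \<subseteq> {..n} \<Longrightarrow> lagrangian n (outer_degree lo hi) X = v \<longleftrightarrow> outer_levels lo hi X"
    using minimizers_outer[OF n] by blast
  ultimately have "minimizes_two_chains n F \<longleftrightarrow>
      (\<forall>xs\<in>permutations_of_set {1..n}. outer_levels lo hi (chain_levels n F xs))"
    using minimizes_iff_chain_levels[OF F sub G(3) _ v] by blast
  then show ?thesis using all_chain_levels_outer[OF _ _ F lt] by simp
qed

lemma minimizes_iff:
  assumes n: "1 \<le> n" "lo + hi = n" "lo \<le> hi" and F: "F \<subseteq> Pow {1..n}"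
    and s: "n choose (n div 2) \<le> card F" "(\<Sum>i\<in>{lo<..<hi}. n choose i) < card F"
      "card F \<le> (\<Sum>i\<in>{lo..hi}. n choose i)"
  shows "minimizes_two_chains n F \<longleftrightarrow>
    (\<forall>A\<in>F. lo \<le> card A \<and> card A \<le> hi) \<and>
    (\<forall>A. A \<subseteq> {1..n} \<and> lo < card A \<and> card A < hi \<longrightarrow> A \<in> F) \<and>
    (card F \<le> (\<Sum>i\<in>{lo..<hi}. n choose i) \<longrightarrow> antichain {A \<in> F. card A = lo \<or> card A = hi}) \<and>
    ((\<Sum>i\<in>{lo..<hi}. n choose i) \<le> card F \<longrightarrow>
      antichain {A. A \<subseteq> {1..n} \<and> A \<notin> F \<and> (card A = lo \<or> card A = hi)})"
proof -
  have fin: "finite A" if "A \<subseteq> {1..n}" for A :: "nat set"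
    using that finite_subset[of A "{1..n}"] by blast
  define N where "N = (\<Sum>i\<in>{lo..<hi}. n choose i)"
  consider "lo + 2 \<le> hi" | "hi = Suc lo" | "hi = lo" using n(3) by linarith
  then show ?thesis
  proof cases
    case 1
    then have lt: "lo < hi" by simp
    have inner: "minimizes_two_chains n F \<longleftrightarrow>
      (\<forall>A\<in>F. lo \<le> card A \<and> card A \<le> hi) \<and>
      (\<forall>A. A \<subseteq> {1..n} \<and> lo < card A \<and> card A < hi \<longrightarrow> A \<in> F) \<and>
      antichain {A \<in> F. card A = lo \<or> card A = hi}" if "card F \<le> N"
      using minimizes_iff_inner[OF n(2) 1 F less_imp_le[OF s(2)] that[unfolded N_def]] .
    have outer: "minimizes_two_chains n F \<longleftrightarrow>
      (\<forall>A\<in>F. lo \<le> card A \<and> card A \<le> hi) \<and>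
      (\<forall>A. A \<subseteq> {1..n} \<and> lo < card A \<and> card A < hi \<longrightarrow> A \<in> F) \<and>
      antichain {A. A \<subseteq> {1..n} \<and> A \<notin> F \<and> (card A = lo \<or> card A = hi)}" if "N \<le> card F"
      using minimizes_iff_outer[OF n(2) lt F that[unfolded N_def] s(3)] .
    \<comment> \<open>At equality both criteria characterise minimality, so demanding (3) and (4)
      together is consistent.\<close>
    have "card F \<le> N \<or> N \<le> card F" by linarith
    then show ?thesis using inner outer unfolding N_def[symmetric] by argo
  next
    case 2
    \<comment> \<open>No layer lies strictly between, so \<open>minimizes_iff_inner\<close> does not
      apply; the lower bound on \<open>card F\<close> puts this case into the outer regime.\<close>
    then have lt: "lo < hi" and lo: "lo = n div 2" using n by auto
    have "{lo..<hi} = {lo}" using 2 by auto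
    then have N: "N = n choose lo" by (simp add: N_def)
    then have le: "N \<le> card F" using s(1) lo by simp
    have outer: "minimizes_two_chains n F \<longleftrightarrow>
      (\<forall>A\<in>F. lo \<le> card A \<and> card A \<le> hi) \<and>
      (\<forall>A. A \<subseteq> {1..n} \<and> lo < card A \<and> card A < hi \<longrightarrow> A \<in> F) \<and>
      antichain {A. A \<subseteq> {1..n} \<and> A \<notin> F \<and> (card A = lo \<or> card A = hi)}"
      using minimizes_iff_outer[OF n(2) lt F le[unfolded N_def] s(3)] .
    \<comment> \<open>At \<open>card F = N\<close> condition (3) is in force too. A full layer of
      this size has no 2-chains, so a minimiser has none either.\<close>
    have "antichain {A \<in> F. card A = lo \<or> card A = hi}"
      if "minimizes_two_chains n F" "card F \<le> N"
    proof -
      define G where "G = {A. A \<subseteq> {1..n} \<and> card A = lo}"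
      have "card G = card F"
        using that(2) le n_subsets[of "{1..n}" lo] by (simp add: G_def N)
      moreover have "two_chains G = {}"
        using antichain_uniform[of G lo] fin by (auto simp: G_def antichain_def)
      moreover have "G \<subseteq> Pow {1..n}" by (auto simp: G_def)
      ultimately have "card (two_chains F) = 0"
        using that(1) unfolding minimizes_two_chains_def by (metis card.empty le_zero_eq)
      moreover have "finite F" using F finite_subset[of F "Pow {1..n}"] by blast
      ultimately have "antichain F" by (simp add: antichain_def finite_two_chains)
      then show ?thesis by (rule antichain_subset) auto
    qed
    then show ?thesis using outer le unfolding N_def[symmetric] by argo
  next
    text \<open>Here \<open>F\<close> is as large as the middle layer, which is also the first regime of the next
      larger radius.\<close>
    case 3
    then have lo: "lo = n div 2" "1 \<le> lo" using n by auto
    have "card F = n choose lo" using s lo 3 by simp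
    define L where "L = {A. A \<subseteq> {1..n} \<and> card A = lo}"
    have L: "finite L" "card L = card F"
      using n_subsets[of "{1..n}" lo] \<open>card F = n choose lo\<close> by (auto simp: L_def)
    have "finite F" using F finite_subset[of F "Pow {1..n}"] by blast
    have mid: "{lo - 1<..<hi + 1} = {lo}" using 3 lo by auto
    have "minimizes_two_chains n F \<longleftrightarrow>
      (\<forall>A\<in>F. lo - 1 \<le> card A \<and> card A \<le> hi + 1) \<and>
      (\<forall>A. A \<subseteq> {1..n} \<and> lo - 1 < card A \<and> card A < hi + 1 \<longrightarrow> A \<in> F) \<and>
      antichain {A \<in> F. card A = lo - 1 \<or> card A = hi + 1}"
    proof (rule minimizes_iff_inner)
      show "card F \<le> (\<Sum>i\<in>{lo - 1..<hi + 1}. n choose i)"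
        unfolding \<open>card F = n choose lo\<close>
        using 3 by (intro member_le_sum) auto
    qed (use n lo 3 F \<open>card F = n choose lo\<close> mid in auto)
    also have "\<dots> \<longleftrightarrow> F = L"
    proof
      assume *: "(\<forall>A\<in>F. lo - 1 \<le> card A \<and> card A \<le> hi + 1) \<and>
        (\<forall>A. A \<subseteq> {1..n} \<and> lo - 1 < card A \<and> card A < hi + 1 \<longrightarrow> A \<in> F) \<and>
        antichain {A \<in> F. card A = lo - 1 \<or> card A = hi + 1}"
      then have "L \<subseteq> F" using 3 lo by (auto simp: L_def)
      then show "F = L" using card_subset_eq[OF \<open>finite F\<close>] L(2) by auto
    next
      assume FL: "F = L"
      then have "{A \<in> F. card A = lo - 1 \<or> card A = hi + 1} = {}"
        using lo 3 by (auto simp: L_def)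
      then have "antichain {A \<in> F. card A = lo - 1 \<or> card A = hi + 1}"
        by (simp only:) (simp add: antichain_def two_chains_def)
      moreover have "A \<in> F \<longleftrightarrow> A \<subseteq> {1..n} \<and> card A = lo" for A
        by (simp add: FL L_def)
      ultimately show "(\<forall>A\<in>F. lo - 1 \<le> card A \<and> card A \<le> hi + 1) \<and>
        (\<forall>A. A \<subseteq> {1..n} \<and> lo - 1 < card A \<and> card A < hi + 1 \<longrightarrow> A \<in> F) \<and>
        antichain {A \<in> F. card A = lo - 1 \<or> card A = hi + 1}"
        using lo 3 by auto
    qed
    also have "\<dots> \<longleftrightarrow> (\<forall>A\<in>F. card A = lo)"
    proof
      assume "\<forall>A\<in>F. card A = lo"
      then have "F \<subseteq> L" using F by (auto simp: L_def)
      then show "F = L" using card_subset_eq[OF L(1)] L(2) by auto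
    qed (auto simp: L_def)
    finally have "minimizes_two_chains n F \<longleftrightarrow> (\<forall>A\<in>F. card A = lo)" .
    \<comment> \<open>Both ends are the same layer, so (4) holds automatically; the threshold sum is
      empty, so the premise of (3) fails.\<close>
    moreover have "antichain {A. A \<subseteq> {1..n} \<and> A \<notin> F \<and> (card A = lo \<or> card A = hi)}"
      using 3 fin by (intro antichain_uniform[of _ lo]) auto
    moreover have "\<not> card F \<le> (\<Sum>i\<in>{lo..<hi}. n choose i)"
      using 3 s(2) by simp
    ultimately show ?thesis using 3 by (auto simp: le_antisym)
  qed
qed

section \<open>From half-integer bounds to integer levels\<close>

lemma binom_sum_eq_sum:
  assumes "\<And>i. i \<le> n \<Longrightarrow> i \<in> T \<longleftrightarrow> a \<le> real i \<and> real i \<le> b" "T \<subseteq> {..n}"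
  shows "binom_sum n a b = (\<Sum>i\<in>T. n choose i)"
  unfolding binom_sum_def
proof (rule sum.mono_neutral_right)
  show "\<forall>i\<in>{i. a \<le> real i \<and> real i \<le> b} - T. n choose i = 0"
    using assms(1) by (metis (mono_tags, lifting) DiffE binomial_eq_0 mem_Collect_eq not_le_imp_less)
qed (use assms finite_binom_sum_index in auto)

text \<open>The upper end cannot exceed \<open>n\<close>: otherwise the inner sum would already run
  over all of \<open>{..n}\<close> and equal \<open>2 ^ n\<close>, not less than \<open>s\<close>.
  By symmetry the lower end is then a natural number.\<close>

lemma is_radius_levels:
  assumes "is_radius n s r" "s \<le> 2 ^ n"
  obtains lo hi :: nat where "lo + hi = n" "lo \<le> hi" "real n / 2 - r = real lo" "real n / 2 + r = real hi"
proof -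
  have r: "0 \<le> r" "real n / 2 + r \<in> \<int>" "binom_sum n (real n / 2 - r + 1) (real n / 2 + r - 1) < s"
    using assms(1) by (auto simp: is_radius_def)
  then obtain k :: int where k: "real n / 2 + r = of_int k" by (auto elim: Ints_cases)
  have "k \<le> int n"
  proof (rule ccontr)
    assume "\<not> k \<le> int n"
    then have "real n + 1 \<le> of_int k" by linarith
    then have big: "real n + 1 \<le> real n / 2 + r" by (simp add: k)
    have "binom_sum n (real n / 2 - r + 1) (real n / 2 + r - 1) = (\<Sum>i\<in>{..n}. n choose i)"
    proof (rule binom_sum_eq_sum)
      fix i assume "i \<le> n"
      then have "real i \<le> real n" "0 \<le> real i" by simp_all
      then show "i \<in> {..n} \<longleftrightarrow> real n / 2 - r + 1 \<le> real i \<and> real i \<le> real n / 2 + r - 1"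
        using big \<open>i \<le> n\<close> by (auto simp: field_simps)
    qed simp
    then show False using r(3) assms(2) by (simp add: choose_row_sum)
  qed
  moreover have "0 \<le> k" using r(1) k by (metis add_nonneg_nonneg divide_nonneg_nonneg of_int_0_le_iff of_nat_0_le_iff zero_le_numeral)
  ultimately obtain hi where hi: "k = int hi" "hi \<le> n" by (metis nonneg_int_cases of_nat_le_iff)
  have "real n / 2 + r = real hi" using k hi by simp
  moreover have "real (n - hi) = real n - real hi" using hi(2) by (simp add: of_nat_diff)
  ultimately have *: "real n / 2 - r = real (n - hi)" by linarith
  have "real (n - hi) \<le> real hi" using * \<open>real n / 2 + r = real hi\<close> r(1) by linarith
  then show thesis using that[of "n - hi" hi] * \<open>real n / 2 + r = real hi\<close> hi(2) by simp
qed

theorem theorem1p2: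
  fixes n s :: nat and F :: "nat set set" and r :: real
  assumes "1 \<le> n"
    and "F \<subseteq> Pow {1..n}"
    and "card F = s"
    and "n choose (n div 2) \<le> s"
    and "is_radius n s r"
  shows "minimizes_two_chains n F \<longleftrightarrow>
      (\<forall>A\<in>F. real n / 2 - r \<le> real (card A) \<and> real (card A) \<le> real n / 2 + r) \<and>
      (\<forall>A. A \<subseteq> {1..n} \<and> real n / 2 - r + 1 \<le> real (card A) \<and> real (card A) \<le> real n / 2 + r - 1
          \<longrightarrow> A \<in> F) \<and>
      (s \<le> binom_sum n (real n / 2 - r) (real n / 2 + r - 1) \<longrightarrow>
         antichain {A \<in> F. real (card A) = real n / 2 - r \<or> real (card A) = real n / 2 + r}) \<and>
      (binom_sum n (real n / 2 - r) (real n / 2 + r - 1) \<le> s \<longrightarrow>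
         antichain {A. A \<subseteq> {1..n} \<and> A \<notin> F \<and>
           (real (card A) = real n / 2 - r \<or> real (card A) = real n / 2 + r)})"
proof -
  have "s \<le> 2 ^ n"
    using card_mono[OF _ assms(2)] assms(3) by (simp add: card_Pow)
  then obtain lo hi where n: "lo + hi = n" "lo \<le> hi"
    and ends: "real n / 2 - r = real lo" "real n / 2 + r = real hi"
    using is_radius_levels[OF assms(5)] by blast
  \<comment> \<open>As the ends are integers, the offsets by 1 turn into strict
    inequalities.\<close>
  have cmp: "real lo + 1 \<le> real k \<longleftrightarrow> lo < k" "real k \<le> real hi - 1 \<longleftrightarrow> k < hi" for k
    by linarith+
  have sums: "binom_sum n (real lo + 1) (real hi - 1) = (\<Sum>i\<in>{lo<..<hi}. n choose i)"
    "binom_sum n (real lo) (real hi - 1) = (\<Sum>i\<in>{lo..<hi}. n choose i)"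
    "binom_sum n (real lo) (real hi) = (\<Sum>i\<in>{lo..hi}. n choose i)"
    by (rule binom_sum_eq_sum; use n in \<open>auto simp: cmp\<close>)+
  have "(\<Sum>i\<in>{lo<..<hi}. n choose i) < s" "s \<le> (\<Sum>i\<in>{lo..hi}. n choose i)"
    using assms(5) unfolding is_radius_def ends sums by auto
  then show ?thesis
    using minimizes_iff[OF assms(1) n assms(2)] assms(3,4)
    unfolding ends sums cmp by simp
qed

end
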